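(* Let $A$ be a quasi-nilpotent bounded linear operator on a complex Banach space $X$. Let $f\in\mathcal P$ be an admissible analytic function defined on a disk $\{z\in\mathbb C:|z|<R\}$, $0<R\le\infty$, and let $\xi$ be the smallest positive solution of $f'(x)=0$. If $\|f(A)\|<f(\xi)$, then $\|A\|<\xi$.
   Context: All Banach spaces are complex. Quasi-nilpotent means that the spectral radius is $0$; $f(A)$ is given by the Riesz-Dunford (holomorphic) functional calculus. Class $\mathcal P$: an analytic function $f$ on a disk $\{z\in\mathbb C:|z|<R\}$ (with $R=\infty$ allowed, in which case $f$ is entire) belongs to $\mathcal P$ if (1) $f(0)=0$; (2) $f'(0)\ne 0$; (3) $f(x)\in\mathbb R$ for real $x$ with $-R<x<R$; (4) the local inverse function $\varphi=f^{-1}$ of $f$ at the origin, defined and analytic in a neighborhood of $0$ with $\varphi(0)=0$, satisfies $\varphi^{(n)}(0)\ge 0$ for all $n\ge1$. A function $f\in\mathcal P$ is admissible if there exists a real $x$ with $0<x<R$ and $f'(x)=0$. *)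

theory Defs
  imports "HOL-Complex_Analysis.Complex_Analysis"
begin

section \<open>Complex Banach spaces and their operators\<close>

class complex_banach = banach +
  fixes scaleC :: "complex \<Rightarrow> 'a \<Rightarrow> 'a"  (infixr "*\<^sub>C" 75)
  assumes scaleC_add_right: "a *\<^sub>C (x + y) = a *\<^sub>C x + a *\<^sub>C y"
    and scaleC_add_left: "(a + b) *\<^sub>C x = a *\<^sub>C x + b *\<^sub>C x"
    and scaleC_scaleC: "a *\<^sub>C b *\<^sub>C x = (a * b) *\<^sub>C x"
    and scaleC_one: "1 *\<^sub>C x = x"
    and scaleR_scaleC: "r *\<^sub>R x = complex_of_real r *\<^sub>C x"
    and norm_scaleC: "norm (a *\<^sub>C x) = cmod a * norm x"

instantiation complex :: complex_banach
begin
definition scaleC_complex :: "complex \<Rightarrow> complex \<Rightarrow> complex" where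
  "scaleC_complex a x = a * x"
instance
  by standard (simp_all add: scaleC_complex_def algebra_simps norm_mult scaleR_conv_of_real)
end

text \<open>Bounded operators are elements of the library type of bounded real-linear maps,
  subject to the predicate \<open>clinear_op\<close>. The operator norm does not depend on the scalar field.\<close>

definition clinear_op :: "('a::complex_banach \<Rightarrow>\<^sub>L 'a) \<Rightarrow> bool" where
  "clinear_op A \<longleftrightarrow> (\<forall>c x. blinfun_apply A (c *\<^sub>C x) = c *\<^sub>C blinfun_apply A x)"

definition scalar_op :: "complex \<Rightarrow> ('a::complex_banach \<Rightarrow>\<^sub>L 'a)" where
  "scalar_op c = Blinfun (\<lambda>x. c *\<^sub>C x)"

lemma bounded_linear_scaleC: "bounded_linear (\<lambda>x::'a::complex_banach. c *\<^sub>C x)"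
proof (rule bounded_linear_intro)
  show "c *\<^sub>C (x + y) = c *\<^sub>C x + c *\<^sub>C y" for x y :: 'a
    by (rule scaleC_add_right)
  show "c *\<^sub>C (r *\<^sub>R x) = r *\<^sub>R (c *\<^sub>C x)" for r and x :: 'a
    by (simp add: scaleR_scaleC scaleC_scaleC mult.commute)
  show "norm (c *\<^sub>C x) \<le> norm x * cmod c" for x :: 'a
    by (simp add: norm_scaleC mult.commute)
qed

lemma scalar_op_apply: "blinfun_apply (scalar_op c) x = c *\<^sub>C x"
  by (simp add: scalar_op_def bounded_linear_Blinfun_apply bounded_linear_scaleC)

section \<open>Spectrum and holomorphic functional calculus\<close>

text \<open>A two-sided inverse of a complex-linear operator is again complex-linear, so it need not
  be required.\<close>

definition is_op_inverse ::
    "('a::complex_banach \<Rightarrow>\<^sub>L 'a) \<Rightarrow> ('a \<Rightarrow>\<^sub>L 'a) \<Rightarrow> bool" where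
  "is_op_inverse T B \<longleftrightarrow> T o\<^sub>L B = id_blinfun \<and> B o\<^sub>L T = id_blinfun"

definition spectrum :: "('a::complex_banach \<Rightarrow>\<^sub>L 'a) \<Rightarrow> complex set" where
  "spectrum A = {z. \<not> (\<exists>B. is_op_inverse (scalar_op z - A) B)}"

definition resolvent :: "('a::complex_banach \<Rightarrow>\<^sub>L 'a) \<Rightarrow> complex \<Rightarrow> ('a \<Rightarrow>\<^sub>L 'a)" where
  "resolvent A z = (THE B. is_op_inverse (scalar_op z - A) B)"

text \<open>The supremum is taken in \<open>ennreal\<close>, so that it is \<open>0\<close> for the empty spectrum
  (the operator on the zero space).\<close>

definition spectral_radius :: "('a::complex_banach \<Rightarrow>\<^sub>L 'a) \<Rightarrow> ennreal" where
  "spectral_radius A = (SUP z\<in>spectrum A. ennreal (cmod z))"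

definition quasi_nilpotent :: "('a::complex_banach \<Rightarrow>\<^sub>L 'a) \<Rightarrow> bool" where
  "quasi_nilpotent A \<longleftrightarrow> spectral_radius A = 0"

text \<open>The library's contour integral is complex-valued; this is the same formula for
  operator-valued integrands.\<close>

definition op_contour_integral ::
    "(real \<Rightarrow> complex) \<Rightarrow> (complex \<Rightarrow> ('a::complex_banach \<Rightarrow>\<^sub>L 'a)) \<Rightarrow> ('a \<Rightarrow>\<^sub>L 'a)" where
  "op_contour_integral \<gamma> F =
     integral {0..1}
       (\<lambda>t. scalar_op (vector_derivative \<gamma> (at t within {0..1})) o\<^sub>L F (\<gamma> t))"

text \<open>Closed contours in the disk of radius \<open>R\<close> that surround the spectrum once. Since the domain is
  a disk, one closed path suffices, and its winding number about points outside the disk is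
  automatically \<open>0\<close>.\<close>

definition spectral_contour ::
    "ereal \<Rightarrow> ('a::complex_banach \<Rightarrow>\<^sub>L 'a) \<Rightarrow> (real \<Rightarrow> complex) \<Rightarrow> bool" where
  "spectral_contour R A \<gamma> \<longleftrightarrow>
     valid_path \<gamma> \<and> pathfinish \<gamma> = pathstart \<gamma> \<and>
     path_image \<gamma> \<subseteq> eball 0 R - spectrum A \<and>
     (\<forall>z\<in>spectrum A. winding_number \<gamma> z = 1)"

text \<open>The Riesz-Dunford operator \<open>f(A)\<close> for \<open>f\<close> analytic on the disk of radius \<open>R\<close> containing the
  spectrum of \<open>A\<close>; by Cauchy's theorem the choice of the contour is immaterial.\<close>

definition riesz_dunford ::
    "ereal \<Rightarrow> (complex \<Rightarrow> complex) \<Rightarrow> ('a::complex_banach \<Rightarrow>\<^sub>L 'a) \<Rightarrow> ('a \<Rightarrow>\<^sub>L 'a)" where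
  "riesz_dunford R f A =
     scalar_op (1 / (2 * of_real pi * \<i>)) o\<^sub>L
     op_contour_integral (SOME \<gamma>. spectral_contour R A \<gamma>)
       (\<lambda>z. scalar_op (f z) o\<^sub>L resolvent A z)"

section \<open>The class P and admissible functions\<close>

definition local_inverse_at_0 ::
    "ereal \<Rightarrow> (complex \<Rightarrow> complex) \<Rightarrow> (complex \<Rightarrow> complex) \<Rightarrow> bool" where
  "local_inverse_at_0 R f \<phi> \<longleftrightarrow>
     \<phi> 0 = 0 \<and>
     (\<exists>U V. open U \<and> 0 \<in> U \<and> U \<subseteq> eball 0 R \<and> open V \<and> 0 \<in> V \<and>
            homeomorphism U V f \<phi> \<and> \<phi> holomorphic_on V)"

text \<open>The germ of the local inverse at \<open>0\<close> is unique, so the quantifier over \<open>\<phi>\<close> below may be read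
  either way.\<close>

definition class_P :: "ereal \<Rightarrow> (complex \<Rightarrow> complex) \<Rightarrow> bool" where
  "class_P R f \<longleftrightarrow>
     f holomorphic_on eball 0 R \<and>
     f 0 = 0 \<and>
     deriv f 0 \<noteq> 0 \<and>
     (\<forall>x::real. ereal \<bar>x\<bar> < R \<longrightarrow> f (of_real x) \<in> \<real>) \<and>
     (\<exists>\<phi>. local_inverse_at_0 R f \<phi> \<and> (\<forall>n\<ge>1. (deriv ^^ n) \<phi> 0 \<in> \<real>\<^sub>\<ge>\<^sub>0))"

definition positive_critical_points :: "ereal \<Rightarrow> (complex \<Rightarrow> complex) \<Rightarrow> real set" where
  "positive_critical_points R f = {x. 0 < x \<and> ereal x < R \<and> deriv f (of_real x) = 0}"

definition admissible :: "ereal \<Rightarrow> (complex \<Rightarrow> complex) \<Rightarrow> bool" where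
  "admissible R f \<longleftrightarrow> class_P R f \<and> positive_critical_points R f \<noteq> {}"

end

theory Submission
  imports Defs
begin

text \<open>
  Put \<open>B = f(A)\<close>, and let \<open>\<phi>\<close> be the local inverse of \<open>f\<close>, with Taylor coefficients \<open>b\<^sub>k \<ge> 0\<close> at
  \<open>0\<close>. If \<open>A = \<phi>(B) = \<Sum> b\<^sub>k B\<^sup>k\<close> can be justified, then \<open>\<parallel>A\<parallel> \<le> \<Sum> b\<^sub>k \<parallel>B\<parallel>\<^sup>k = \<phi>(\<parallel>B\<parallel>)\<close> because the
  coefficients are nonnegative, and \<open>\<phi>(\<parallel>B\<parallel>) < \<xi>\<close> because \<open>\<phi>\<close> inverts the strictly increasing function
  \<open>f\<close> between \<open>[0, \<xi>)\<close> and \<open>[0, f(\<xi>))\<close>. Three things have to be shown.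

  \<^item> \<^emph>\<open>The operator \<open>f(A)\<close> is the sum of the Taylor series of \<open>f\<close> at \<open>A\<close>.\<close> Since \<open>A\<close> is quasi-nilpotent,
    \<open>\<parallel>A\<^sup>n\<parallel> r\<^sup>n\<close> is summable for every \<open>r > 0\<close>. This is proved here without Cauchy's theorem for
    operator-valued functions, by averaging the resolvent over roots of unity
    (\<open>small_op_power_ball\<close>). A contour in the sense of the definition is continuously
    differentiable only off finitely many parameters, near which its derivative may be unbounded; it may have
    infinite length, so the Neumann series of the resolvent cannot be integrated term by term along it.
    Instead, \<open>f(z) (z - A)\<^sup>-\<^sup>1 - z\<^sup>-\<^sup>1 f(A)\<close> is given a primitive on the punctured disk
    (\<open>resolvent_primitive\<close>), and the fundamental theorem of calculus leaves only the winding
    number of the contour around \<open>0\<close> (\<open>riesz_dunford_eq_series_calculus\<close>).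

  \<^item> \<^emph>\<open>The series calculus respects products and composition.\<close> By Cauchy's inequality it is
    continuous for uniform convergence near \<open>0\<close>, so both properties pass from polynomials to limits
    (\<open>series_calculus_mult\<close>, \<open>series_calculus_compose\<close>). The identity \<open>\<phi> \<circ> f = id\<close> near \<open>0\<close>
    then gives \<open>A = \<Sum> b\<^sub>k B\<^sup>k\<close> (\<open>series_calculus_inverse\<close>), with no smallness condition on \<open>B\<close>.

  \<^item> \<^emph>\<open>The series \<open>\<Sum> b\<^sub>k y\<^sup>k\<close> converges for all \<open>0 \<le> y < f(\<xi>)\<close> and inverts \<open>f\<close> there.\<close> If its radius
    of convergence were some \<open>\<rho> < f(\<xi>)\<close>, then \<open>\<rho> = f(x)\<close> with \<open>0 < x < \<xi>\<close>, and since \<open>f'(x) \<noteq> 0\<close> the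
    sum of the series would extend analytically past \<open>\<rho>\<close>. For nonnegative coefficients this is
    impossible by the argument of Pringsheim's theorem (\<open>nonneg_power_series_le_extension\<close>,
    \<open>conv_radius_ge\<close>).
\<close>

section \<open>Operators as a complex Banach space\<close>

interpretation scaleC: bounded_bilinear "scaleC :: complex \<Rightarrow> 'a::complex_banach \<Rightarrow> 'a"
proof
  show "(r *\<^sub>R a) *\<^sub>C b = r *\<^sub>R (a *\<^sub>C b)" for r a and b :: 'a
    by (simp only: scaleR_conv_of_real scaleR_scaleC[where 'a = 'a] scaleC_scaleC)
  show "a *\<^sub>C (r *\<^sub>R b) = r *\<^sub>R (a *\<^sub>C b)" for r a and b :: 'a
    by (simp add: scaleR_scaleC scaleC_scaleC mult.commute)
  show "\<exists>K. \<forall>a b. norm (a *\<^sub>C (b::'a)) \<le> norm a * norm b * K"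
    by (rule exI[of _ 1]) (simp add: norm_scaleC)
qed (simp_all add: scaleC_add_left scaleC_add_right)

declare scaleC_one [simp] scaleC.zero_left [simp] scaleC.zero_right [simp]

interpretation blinfun_compose: bounded_bilinear
  "blinfun_compose :: ('b::real_normed_vector \<Rightarrow>\<^sub>L 'c::real_normed_vector) \<Rightarrow> ('a::real_normed_vector \<Rightarrow>\<^sub>L 'b) \<Rightarrow> _"
  by (rule bounded_bilinear_blinfun_compose)

text \<open>The bounded operators themselves form a complex Banach space. This makes power series with
  operator coefficients an instance of power series with coefficients in a complex Banach space.\<close>

instantiation blinfun :: (real_normed_vector, complex_banach) complex_banach
begin

definition scaleC_blinfun :: "complex \<Rightarrow> ('a \<Rightarrow>\<^sub>L 'b) \<Rightarrow> ('a \<Rightarrow>\<^sub>L 'b)" where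
  "scaleC_blinfun c T = scalar_op c o\<^sub>L T"

lemma scaleC_blinfun_apply: "blinfun_apply (c *\<^sub>C T) x = c *\<^sub>C blinfun_apply T x"
  for T :: "'a \<Rightarrow>\<^sub>L 'b"
  by (simp add: scaleC_blinfun_def scalar_op_apply)

instance
proof
  fix a b :: complex and S T :: "'a \<Rightarrow>\<^sub>L 'b"
  show "a *\<^sub>C (S + T) = a *\<^sub>C S + a *\<^sub>C T"
    by (rule blinfun_eqI) (simp add: scaleC_blinfun_apply blinfun.bilinear_simps scaleC_add_right)
  show "(a + b) *\<^sub>C T = a *\<^sub>C T + b *\<^sub>C T"
    by (rule blinfun_eqI) (simp add: scaleC_blinfun_apply blinfun.bilinear_simps scaleC_add_left)
  show "a *\<^sub>C b *\<^sub>C T = (a * b) *\<^sub>C T"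
    by (rule blinfun_eqI) (simp add: scaleC_blinfun_apply scaleC_scaleC)
  show one: "1 *\<^sub>C T = T" for T :: "'a \<Rightarrow>\<^sub>L 'b"
    by (rule blinfun_eqI) (simp add: scaleC_blinfun_apply scaleC_one)
  show "r *\<^sub>R T = complex_of_real r *\<^sub>C T" for r
    by (rule blinfun_eqI) (simp add: scaleC_blinfun_apply blinfun.bilinear_simps scaleR_scaleC)
  have le: "norm (c *\<^sub>C U) \<le> cmod c * norm U" for c and U :: "'a \<Rightarrow>\<^sub>L 'b"
    by (rule norm_blinfun_bound)
      (auto simp: scaleC_blinfun_apply norm_scaleC mult.assoc intro!: mult_left_mono norm_blinfun)
  show "norm (a *\<^sub>C T) = cmod a * norm T"
  proof (cases "a = 0")
    case True
    then show ?thesis using le[of 0 T] by simp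
  next
    case False
    have "T = inverse a *\<^sub>C (a *\<^sub>C T)"
      by (rule blinfun_eqI) (simp add: scaleC_blinfun_apply scaleC_scaleC scaleC_one False)
    then have "norm T \<le> cmod (inverse a) * norm (a *\<^sub>C T)"
      using le by metis
    then have "cmod a * norm T \<le> norm (a *\<^sub>C T)"
      using False by (simp add: norm_inverse norm_divide field_simps)
    then show ?thesis using le[of a T] by linarith
  qed
qed

end

lemma scalar_op_eq_scaleC: "scalar_op c = c *\<^sub>C id_blinfun"
  by (rule blinfun_eqI) (simp add: scalar_op_apply scaleC_blinfun_apply)

lemma scalar_op_compose: "scalar_op c o\<^sub>L T = c *\<^sub>C T"
  by (simp add: scaleC_blinfun_def)

lemma scaleC_compose_left: "(c *\<^sub>C S) o\<^sub>L T = c *\<^sub>C (S o\<^sub>L T)"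
  by (rule blinfun_eqI) (simp add: scaleC_blinfun_apply)

lemma scaleC_compose_right:
  assumes "clinear_op S"
  shows "S o\<^sub>L (c *\<^sub>C T) = c *\<^sub>C (S o\<^sub>L T)"
  using assms by (intro blinfun_eqI) (simp add: scaleC_blinfun_apply clinear_op_def)

lemma blinfun_compose_assoc: "(S o\<^sub>L T) o\<^sub>L U = S o\<^sub>L (T o\<^sub>L U)"
  by (rule blinfun_eqI) simp

lemma id_blinfun_compose [simp]: "id_blinfun o\<^sub>L T = T" "T o\<^sub>L id_blinfun = T"
  by (rule blinfun_eqI; simp)+

text \<open>Operators are only real-linear maps here, and pulling a complex scalar through a composition from
  the right needs complex linearity of the left factor; so it has to be known for resolvents.\<close>

lemma clinear_op_inverse:
  assumes "clinear_op T" "is_op_inverse T B"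
  shows "clinear_op B"
  unfolding clinear_op_def
proof (intro allI)
  fix c x
  have TB: "T (B y) = y" and BT: "B (T y) = y" for y
    using assms(2) by (metis is_op_inverse_def blinfun_apply_blinfun_compose blinfun_apply_id_blinfun id_apply)+
  have "B (c *\<^sub>C x) = B (T (c *\<^sub>C B x))"
    using assms(1) TB by (simp add: clinear_op_def)
  then show "B (c *\<^sub>C x) = c *\<^sub>C B x"
    by (simp only: BT)
qed

lemma is_op_inverse_scaleC:
  assumes "clinear_op T" "is_op_inverse T B" "c \<noteq> 0"
  shows "is_op_inverse (c *\<^sub>C T) ((1 / c) *\<^sub>C B)"
  using assms clinear_op_inverse[OF assms(1,2)]
  by (simp add: is_op_inverse_def scaleC_compose_left scaleC_compose_right scaleC_scaleC)

primrec op_power :: "('a::real_normed_vector \<Rightarrow>\<^sub>L 'a) \<Rightarrow> nat \<Rightarrow> ('a \<Rightarrow>\<^sub>L 'a)" where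
  "op_power A 0 = id_blinfun"
| "op_power A (Suc n) = A o\<^sub>L op_power A n"

lemma op_power_add: "op_power A (m + n) = op_power A m o\<^sub>L op_power A n"
  by (induction m) (simp_all add: blinfun_compose_assoc)

lemma op_power_Suc_right: "op_power A (Suc n) = op_power A n o\<^sub>L A"
  using op_power_add[of A n 1] by simp

lemma op_power_mult: "op_power A (m * n) = op_power (op_power A m) n"
  by (induction n) (simp_all add: op_power_add)

lemma clinear_op_power: "clinear_op A \<Longrightarrow> clinear_op (op_power A n)"
  by (induction n) (simp_all add: clinear_op_def)

lemma norm_op_power_le: "norm (op_power A n) \<le> norm A ^ n"
proof (induction n)
  case 0
  then show ?case by (simp add: norm_blinfun_id_le)
next
  case (Suc n)
  have "norm (op_power A (Suc n)) \<le> norm A * norm (op_power A n)"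
    by (simp add: norm_blinfun_compose)
  also have "\<dots> \<le> norm A * norm A ^ n"
    by (intro mult_left_mono Suc) auto
  finally show ?case by simp
qed

section \<open>Powers of an operator without nonzero spectrum\<close>

lemma sum_powers_root_of_unity:
  fixes N j :: nat
  assumes "0 < j" "j < N"
  shows "(\<Sum>k<N. (cis (2 * pi / N) ^ k) ^ j) = 0"
proof -
  let ?u = "cis (2 * pi / N) ^ j"
  have u: "?u = exp (2 * of_real pi * \<i> * of_nat j / of_nat N)"
  proof -
    have "?u = exp (of_nat j * (\<i> * of_real (2 * pi / N)))"
      by (simp only: cis_conv_exp exp_of_nat_mult)
    also have "of_nat j * (\<i> * of_real (2 * pi / N)) = 2 * of_real pi * \<i> * of_nat j / of_nat N"
      by simp
    finally show ?thesis .
  qed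
  have "?u \<noteq> 1"
    unfolding u using assms by (subst complex_root_unity_eq_1) (auto dest: dvd_imp_le)
  moreover have "?u ^ N = 1"
    unfolding u by (rule complex_root_unity) (use assms in auto)
  ultimately have "(\<Sum>k<N. ?u ^ k) = 0"
    by (subst geometric_sum) auto
  then show ?thesis
    by (simp add: power_mult[symmetric] mult.commute)
qed

lemma op_geometric_sum:
  assumes "clinear_op A"
  shows "(\<Sum>j<N. u ^ j *\<^sub>C op_power A j) o\<^sub>L (id_blinfun - u *\<^sub>C A) =
    id_blinfun - u ^ N *\<^sub>C op_power A N"
proof (induction N)
  case 0
  then show ?case by (simp add: scaleC_one)
next
  case (Suc N)
  have "(u ^ N *\<^sub>C op_power A N) o\<^sub>L (id_blinfun - u *\<^sub>C A) =
     u ^ N *\<^sub>C op_power A N - u ^ Suc N *\<^sub>C op_power A (Suc N)"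
    unfolding op_power_Suc_right
    by (simp add: blinfun_compose.diff_right scaleC_compose_left scaleC_compose_right
        clinear_op_power[OF assms] scaleC_scaleC scaleC.diff_right mult.commute)
  with Suc show ?case
    by (simp add: blinfun_compose.add_left)
qed

text \<open>If \<open>\<zeta>\<close> runs through the \<open>N\<close>-th roots of unity, the average of \<open>(1 - \<zeta>wA)\<^sup>-\<^sup>1\<close> inverts
  \<open>1 - w\<^sup>NA\<^sup>N\<close>: multiplied by \<open>1 - w\<^sup>NA\<^sup>N = 1 - (\<zeta>wA)\<^sup>N\<close>, each term becomes a finite geometric
  sum, and averaging over \<open>\<zeta>\<close> kills all of its terms except the constant one.\<close>

lemma op_average_identity:
  fixes A :: "'a::complex_banach \<Rightarrow>\<^sub>L 'a"
  assumes "clinear_op A" "0 < N"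
    and S: "\<And>k. k < N \<Longrightarrow>
      (id_blinfun - (cis (2 * pi / N) ^ k * w) *\<^sub>C A) o\<^sub>L S (cis (2 * pi / N) ^ k * w) = id_blinfun"
  shows "(id_blinfun - w ^ N *\<^sub>C op_power A N) o\<^sub>L
     ((1 / real N) *\<^sub>R (\<Sum>k<N. S (cis (2 * pi / N) ^ k * w))) = id_blinfun"
proof -
  let ?z = "\<lambda>k::nat. cis (2 * pi / N) ^ k"
  have "cis (2 * pi / N) ^ N = 1"
  proof -
    have "real N * (2 * pi / real N) = 2 * pi"
      using assms(2) by simp
    then show ?thesis by (simp only: Complex.DeMoivre cis_2pi)
  qed
  then have zN: "?z k ^ N = 1" for k
    by (simp only: power_mult[symmetric] mult.commute[of k N]) (simp only: power_mult power_one)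
  have *: "(id_blinfun - w ^ N *\<^sub>C op_power A N) o\<^sub>L S (?z k * w) =
      (\<Sum>j<N. (?z k ^ j * w ^ j) *\<^sub>C op_power A j)" if "k < N" for k
  proof -
    have "(\<Sum>j<N. (?z k * w) ^ j *\<^sub>C op_power A j) o\<^sub>L (id_blinfun - (?z k * w) *\<^sub>C A) =
      id_blinfun - w ^ N *\<^sub>C op_power A N"
      by (subst op_geometric_sum[OF assms(1)]) (simp add: power_mult_distrib zN)
    then have "(id_blinfun - w ^ N *\<^sub>C op_power A N) o\<^sub>L S (?z k * w) =
       (\<Sum>j<N. (?z k * w) ^ j *\<^sub>C op_power A j) o\<^sub>L
         ((id_blinfun - (?z k * w) *\<^sub>C A) o\<^sub>L S (?z k * w))"
      by (simp only: blinfun_compose_assoc[symmetric])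
    then show ?thesis
      using S[OF that] by (simp add: power_mult_distrib)
  qed
  have "(id_blinfun - w ^ N *\<^sub>C op_power A N) o\<^sub>L (\<Sum>k<N. S (?z k * w)) =
      (\<Sum>k<N. \<Sum>j<N. (?z k ^ j * w ^ j) *\<^sub>C op_power A j)"
    using * by (simp add: blinfun_compose.sum_right)
  also have "\<dots> = (\<Sum>j<N. ((\<Sum>k<N. ?z k ^ j) * w ^ j) *\<^sub>C op_power A j)"
    by (subst sum.swap) (simp add: scaleC.sum_left sum_distrib_right)
  also have "\<dots> = (\<Sum>j<N. if j = 0 then of_nat N *\<^sub>C id_blinfun else 0)"
    using sum_powers_root_of_unity by (intro sum.cong) auto
  also have "\<dots> = real N *\<^sub>R id_blinfun"
    using assms(2) by (simp add: scaleR_scaleC)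
  finally show ?thesis
    using assms(2) by (simp add: blinfun_compose.scaleR_right)
qed

text \<open>The resolvent identity \<open>S(w) - S(v) = (w - v) S(w) A S(v)\<close> first bounds \<open>S(w)\<close> for \<open>w\<close> close to
  \<open>v\<close> and then gives continuity.\<close>

lemma op_inverse_pencil_continuous:
  fixes A :: "'a::complex_banach \<Rightarrow>\<^sub>L 'a"
  assumes inv: "\<And>w. w \<in> D \<Longrightarrow> is_op_inverse (id_blinfun - w *\<^sub>C A) (S w)"
  shows "continuous_on D S"
proof -
  have res: "norm (S w - S v) \<le> norm (S w) * (cmod (w - v) * norm A) * norm (S v)"
    if "w \<in> D" "v \<in> D" for w v
  proof -
    have l: "S w o\<^sub>L (id_blinfun - w *\<^sub>C A) = id_blinfun"
      and r: "(id_blinfun - v *\<^sub>C A) o\<^sub>L S v = id_blinfun"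
      using inv that by (auto simp: is_op_inverse_def)
    have "(w - v) *\<^sub>C A = (id_blinfun - v *\<^sub>C A) - (id_blinfun - w *\<^sub>C A)"
      by (simp add: scaleC.diff_left)
    then have "S w o\<^sub>L ((w - v) *\<^sub>C A) o\<^sub>L S v =
      (S w o\<^sub>L ((id_blinfun - v *\<^sub>C A) o\<^sub>L S v)) - ((S w o\<^sub>L (id_blinfun - w *\<^sub>C A)) o\<^sub>L S v)"
      by (simp only: blinfun_compose.diff_left blinfun_compose.diff_right blinfun_compose_assoc)
    then have "S w o\<^sub>L ((w - v) *\<^sub>C A) o\<^sub>L S v = S w - S v"
      using l r by simp
    then have "norm (S w - S v) \<le> norm (S w o\<^sub>L ((w - v) *\<^sub>C A)) * norm (S v)"
      by (metis norm_blinfun_compose)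
    also have "\<dots> \<le> norm (S w) * norm ((w - v) *\<^sub>C A) * norm (S v)"
      by (intro mult_right_mono norm_blinfun_compose) auto
    finally show ?thesis by (simp add: norm_scaleC)
  qed
  show ?thesis
    unfolding continuous_on_def
  proof
    fix v assume v: "v \<in> D"
    define c where "c = norm A * norm (S v)"
    have c: "c \<ge> 0" by (simp add: c_def)
    have lim: "((\<lambda>w. cmod (w - v) * c) \<longlongrightarrow> 0) (at v within D)"
      by (auto intro!: tendsto_eq_intros)
    have bound: "norm (S w - S v) \<le> 2 * norm (S v) * (cmod (w - v) * c)"
      if w: "w \<in> D" and small: "cmod (w - v) * c \<le> 1/2" for w
    proof -
      have *: "norm (S w - S v) \<le> norm (S w) * (cmod (w - v) * c)"
        using res[OF w v] by (simp add: c_def mult_ac)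
      also have "\<dots> \<le> norm (S w) * (1/2)"
        by (intro mult_left_mono small) auto
      finally have "norm (S w) \<le> 2 * norm (S v)"
        using norm_triangle_ineq2[of "S w" "S v"] by linarith
      then have "norm (S w) * (cmod (w - v) * c) \<le> 2 * norm (S v) * (cmod (w - v) * c)"
        using c by (intro mult_right_mono) auto
      with * show ?thesis by linarith
    qed
    have "\<forall>\<^sub>F w in at v within D. cmod (w - v) * c < 1/2"
      using lim by (rule order_tendstoD) simp
    moreover have "\<forall>\<^sub>F w in at v within D. w \<in> D"
      by (auto simp: eventually_at_topological)
    ultimately have "\<forall>\<^sub>F w in at v within D. norm (S w - S v) \<le> 2 * norm (S v) * (cmod (w - v) * c)"
      by eventually_elim (rule bound, auto)
    moreover have "((\<lambda>w. 2 * norm (S v) * (cmod (w - v) * c)) \<longlongrightarrow> 0) (at v within D)"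
      using tendsto_mult_right_zero[OF lim] by simp
    ultimately have "((\<lambda>w. S w - S v) \<longlongrightarrow> 0) (at v within D)"
      by (rule Lim_null_comparison)
    then show "(S \<longlongrightarrow> S v) (at v within D)"
      by (simp add: LIM_zero_iff)
  qed
qed

text \<open>This half of the spectral radius formula avoids integration of operator-valued functions.
  The powers of \<open>sA\<close> tend to \<open>0\<close> precisely when the averages of \<open>op_average_identity\<close> tend to the
  identity. By uniform continuity on the closed disk of radius \<open>r\<close>, the averages at radii \<open>s\<close> and
  \<open>t\<close> differ by at most \<open>1/4\<close>, uniformly in \<open>N\<close>, once \<open>t - s < d\<close>. So smallness of some power can be
  carried from radius \<open>0\<close> to radius \<open>r\<close> in finitely many steps of the same length.\<close>

lemma small_op_power_ball:
  fixes A :: "'a::complex_banach \<Rightarrow>\<^sub>L 'a"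
  assumes A: "clinear_op A" and "0 \<le> r"
    and inv: "\<And>w. cmod w \<le> r \<Longrightarrow> \<exists>S. is_op_inverse (id_blinfun - w *\<^sub>C A) S"
  shows "\<exists>N\<ge>1. norm (op_power A N) * r ^ N \<le> 1/2"
proof -
  obtain S where S: "\<And>w. w \<in> cball 0 r \<Longrightarrow> is_op_inverse (id_blinfun - w *\<^sub>C A) (S w)"
    using inv by (metis mem_cball_0)
  have "uniformly_continuous_on (cball 0 r) S"
    by (intro compact_uniformly_continuous op_inverse_pencil_continuous[of _ A] S) auto
  then obtain d where d: "d > 0"
    and dS: "\<And>v w. v \<in> cball 0 r \<Longrightarrow> w \<in> cball 0 r \<Longrightarrow> dist w v < d \<Longrightarrow> dist (S w) (S v) < 1/4"
    unfolding uniformly_continuous_on_def by (metis zero_less_divide_1_iff zero_less_numeral)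
  define P where "P s \<longleftrightarrow> (\<exists>N\<ge>1. norm (op_power A N) * s ^ N \<le> 1/2)" for s
  have step: "P t" if "P s" "0 \<le> s" "s \<le> t" "t \<le> r" "t < s + d" for s t
  proof -
    obtain N0 where N0: "N0 \<ge> 1" "norm (op_power A N0) * s ^ N0 \<le> 1/2"
      using \<open>P s\<close> by (auto simp: P_def)
    \<comment> \<open>The fifth power turns the bound \<open>1/2\<close> into \<open>1/32\<close>; then the two errors \<open>1/31\<close> and \<open>1/4\<close> below add
      up to at most \<open>1/3\<close>, which suffices to recover the bound \<open>1/2\<close>.\<close>
    define N where "N = N0 * 5"
    have N: "N \<ge> 1" using N0 by (simp add: N_def)
    let ?z = "\<lambda>k::nat. cis (2 * pi / N) ^ k"
    define M where "M x = (1 / real N) *\<^sub>R (\<Sum>k<N. S (?z k * of_real x))" for x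
    define X where "X x = of_real x ^ N *\<^sub>C op_power A N" for x
    have nz: "cmod (?z k * of_real x) = \<bar>x\<bar>" for x k
      by (simp add: norm_mult norm_power)
    have MX: "M x = id_blinfun + (X x o\<^sub>L M x)" if "0 \<le> x" "x \<le> r" for x
    proof -
      have "(id_blinfun - X x) o\<^sub>L M x = id_blinfun"
        unfolding M_def X_def
        by (rule op_average_identity[OF A])
          (use N that S in \<open>auto simp: is_op_inverse_def nz\<close>)
      then show ?thesis
        by (simp add: blinfun_compose.diff_left algebra_simps)
    qed
    have Xs: "norm (X s) \<le> 1/32"
    proof -
      have "norm (op_power A N) \<le> norm (op_power A N0) ^ 5"
        unfolding N_def op_power_mult by (rule norm_op_power_le)
      then have "norm (X s) \<le> norm (op_power A N0) ^ 5 * s ^ N"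
        using \<open>0 \<le> s\<close> by (simp add: X_def norm_scaleC norm_power mult.commute mult_left_mono)
      also have "\<dots> = (norm (op_power A N0) * s ^ N0) ^ 5"
        by (simp add: N_def power_mult power_mult_distrib)
      also have "\<dots> \<le> (1/2) ^ 5"
        using N0 \<open>0 \<le> s\<close> by (intro power_mono) auto
      finally show ?thesis by (simp add: power_divide)
    qed
    have XM: "norm (X s o\<^sub>L M s) \<le> 1/31"
    proof -
      have 1: "norm (X s o\<^sub>L M s) \<le> 1/32 * norm (M s)"
        by (rule order_trans[OF norm_blinfun_compose]) (intro mult_right_mono Xs norm_ge_zero)
      have "norm (M s) \<le> norm (id_blinfun :: 'a \<Rightarrow>\<^sub>L 'a) + norm (X s o\<^sub>L M s)"
        by (subst MX) (use that in \<open>auto intro: norm_triangle_ineq\<close>)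
      with norm_blinfun_id_le[where 'a = 'a] 1 show ?thesis by linarith
    qed
    have diff: "norm (M t - M s) \<le> 1/4"
    proof -
      have "norm (\<Sum>k<N. S (?z k * of_real t) - S (?z k * of_real s)) \<le> (\<Sum>k<N. 1/4)"
      proof (rule sum_norm_le)
        fix k
        have "dist (?z k * of_real t) (?z k * of_real s) = cmod (?z k * of_real (t - s))"
          by (simp add: dist_norm algebra_simps)
        also have "\<dots> < d" unfolding nz using that by simp
        finally have "dist (S (?z k * of_real t)) (S (?z k * of_real s)) < 1/4"
          using that by (intro dS) (simp_all add: nz)
        then show "norm (S (?z k * of_real t) - S (?z k * of_real s)) \<le> 1/4"
          by (simp add: dist_norm)
      qed
      then have "1 / real N * norm (\<Sum>k<N. S (?z k * of_real t) - S (?z k * of_real s)) \<le> 1 / real N * (N * (1/4))"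
        by (intro mult_left_mono) auto
      moreover have "M t - M s = (1 / real N) *\<^sub>R (\<Sum>k<N. S (?z k * of_real t) - S (?z k * of_real s))"
        by (simp add: M_def sum_subtractf scaleR_diff_right)
      ultimately show ?thesis using N by simp
    qed
    have "0 \<le> t" "t \<le> r" using that by auto
    define E where "E = X t o\<^sub>L M t"
    have "E = (M t - M s) + (X s o\<^sub>L M s)"
    proof -
      have "X x o\<^sub>L M x = M x - id_blinfun" if "0 \<le> x" "x \<le> r" for x
        using MX[OF that] by (metis add_diff_cancel_left')
      with that show ?thesis by (simp add: E_def)
    qed
    then have E: "norm E \<le> 1/3"
      using norm_triangle_ineq[of "M t - M s" "X s o\<^sub>L M s"] diff XM by simp
    have "E = X t + (X t o\<^sub>L E)"
    proof -
      have "E = X t o\<^sub>L (id_blinfun + E)"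
        unfolding E_def by (rule arg_cong[OF MX[OF \<open>0 \<le> t\<close> \<open>t \<le> r\<close>]])
      then show ?thesis by (simp add: blinfun_compose.add_right)
    qed
    then have "norm (X t) \<le> norm E + norm (X t o\<^sub>L E)"
      by (metis add_diff_cancel_right' norm_triangle_ineq4)
    also have "\<dots> \<le> 1/3 + norm (X t) * (1/3)"
      by (intro add_mono E order_trans[OF norm_blinfun_compose] mult_left_mono) auto
    finally have "norm (X t) \<le> 1/2" by simp
    then have "norm (op_power A N) * t ^ N \<le> 1/2"
      using \<open>0 \<le> t\<close> by (simp add: X_def norm_scaleC norm_power mult.commute)
    then show ?thesis using N by (auto simp: P_def)
  qed
  obtain K :: nat where K: "r < K * d"
    using d by (metis reals_Archimedean3)
  define e where "e = r / K"
  have e: "0 \<le> e" "e < d"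
    using K \<open>0 \<le> r\<close> d by (cases "K = 0"; simp add: e_def field_simps)+
  have "P (min r (k * e))" for k :: nat
  proof (induction k)
    case 0
    show ?case using \<open>0 \<le> r\<close> by (auto simp: P_def intro!: exI[of _ 1])
  next
    case (Suc k)
    have "real (Suc k) * e = k * e + e" "0 \<le> k * e"
      using e by (simp_all add: algebra_simps)
    with e \<open>0 \<le> r\<close> show ?case
      by (intro step[OF Suc]) (simp_all add: min_def)
  qed
  from this[of K] have "P r"
  proof (cases "K = 0")
    case True
    with K \<open>0 \<le> r\<close> show ?thesis by simp
  qed (simp add: e_def)
  then show ?thesis by (simp add: P_def)
qed

text \<open>Equivalently, \<open>\<parallel>A\<^sup>n\<parallel>\<close> raised to the power \<open>1/n\<close> tends to \<open>0\<close>; in this form the condition yields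
  all the convergence statements below directly.\<close>

definition rapidly_decaying :: "('a::real_normed_vector \<Rightarrow>\<^sub>L 'a) \<Rightarrow> bool" where
  "rapidly_decaying A \<longleftrightarrow> (\<forall>r>0. summable (\<lambda>n. norm (op_power A n) * r ^ n))"

text \<open>A power of norm at most \<open>1/2\<close>, after scaling by \<open>2r\<close>, bounds all the powers of \<open>2rA\<close> by
  submultiplicativity, and the spare factor \<open>2\<close> then provides a convergent geometric majorant for
  the powers of \<open>rA\<close>.\<close>

lemma rapidly_decayingI:
  assumes "\<And>r. 0 < r \<Longrightarrow> \<exists>N\<ge>1. norm (op_power A N) * r ^ N \<le> 1/2"
  shows "rapidly_decaying A"
  unfolding rapidly_decaying_def
proof (intro allI impI)
  fix r :: real assume r: "r > 0"
  obtain N where N: "N \<ge> 1" "norm (op_power A N) * (2 * r) ^ N \<le> 1/2"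
    using assms[of "2 * r"] r by auto
  define C where "C = (\<Sum>j<N. norm (op_power A j) * (2 * r) ^ j)"
  have bound: "norm (op_power A n) * (2 * r) ^ n \<le> C" for n
  proof -
    let ?q = "n div N" and ?j = "n mod N"
    have n: "n = N * ?q + ?j" by simp
    have "norm (op_power A n) \<le> norm (op_power A (N * ?q)) * norm (op_power A ?j)"
      by (subst n) (simp only: op_power_add norm_blinfun_compose)
    also have "\<dots> \<le> norm (op_power A N) ^ ?q * norm (op_power A ?j)"
      unfolding op_power_mult by (intro mult_right_mono norm_op_power_le) auto
    finally have "norm (op_power A n) * (2 * r) ^ n \<le>
      norm (op_power A N) ^ ?q * norm (op_power A ?j) * (2 * r) ^ n"
      using r by (intro mult_right_mono) auto
    also have r_n: "(2 * r) ^ n = ((2 * r) ^ N) ^ ?q * (2 * r) ^ ?j"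
      by (subst n) (simp only: power_add power_mult)
    also have "norm (op_power A N) ^ ?q * norm (op_power A ?j) * (((2 * r) ^ N) ^ ?q * (2 * r) ^ ?j) =
       (norm (op_power A N) * (2 * r) ^ N) ^ ?q * (norm (op_power A ?j) * (2 * r) ^ ?j)"
      by (simp add: power_mult_distrib)
    also have "\<dots> \<le> 1 * (norm (op_power A ?j) * (2 * r) ^ ?j)"
      using N r by (intro mult_right_mono power_le_one) auto
    also have "\<dots> \<le> C"
      unfolding C_def mult_1 using r N
      by (intro member_le_sum[of ?j "{..<N}" "\<lambda>j. norm (op_power A j) * (2 * r) ^ j"]) auto
    finally show ?thesis unfolding r_n .
  qed
  show "summable (\<lambda>n. norm (op_power A n) * r ^ n)"
  proof (rule summable_comparison_test'[of "\<lambda>n. C * (1/2) ^ n"])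
    show "summable (\<lambda>n. C * (1/2) ^ n)" by (intro summable_mult summable_geometric) auto
    show "norm (norm (op_power A n) * r ^ n) \<le> C * (1/2) ^ n" for n
      using bound[of n] r by (simp add: power_mult_distrib power_divide field_simps)
  qed
qed

lemma rapidly_decaying_if_spectrum_0:
  fixes A :: "'a::complex_banach \<Rightarrow>\<^sub>L 'a"
  assumes A: "clinear_op A" and sp: "spectrum A \<subseteq> {0}"
  shows "rapidly_decaying A"
proof (intro rapidly_decayingI small_op_power_ball A)
  fix w
  show "\<exists>S. is_op_inverse (id_blinfun - w *\<^sub>C A) S"
  proof (cases "w = 0")
    case True
    then have "id_blinfun - w *\<^sub>C A = id_blinfun"
      by (simp add: scaleC.zero_left)
    then show ?thesis by (auto simp: is_op_inverse_def intro!: exI[of _ id_blinfun])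
  next
    case False
    then have "1 / w \<notin> spectrum A" using sp by auto
    then obtain B where B: "is_op_inverse (scalar_op (1 / w) - A) B"
      by (auto simp: spectrum_def)
    have eq: "id_blinfun - w *\<^sub>C A = w *\<^sub>C (scalar_op (1 / w) - A)"
      by (simp add: scalar_op_eq_scaleC scaleC.diff_right scaleC_scaleC scaleC_one False)
    have "clinear_op (scalar_op (1 / w) - A)"
      using A by (simp add: clinear_op_def scalar_op_apply blinfun.bilinear_simps
          scaleC_scaleC mult.commute scaleC.diff_right)
    then have "is_op_inverse (id_blinfun - w *\<^sub>C A) ((1 / w) *\<^sub>C B)"
      unfolding eq by (intro is_op_inverse_scaleC B False \<open>clinear_op (scalar_op (1 / w) - A)\<close>)
    then show ?thesis by blast
  qed
qed auto

section \<open>The resolvent and its Neumann series\<close>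

lemma rapidly_decaying_summable:
  assumes "rapidly_decaying A" "0 < r" and a: "\<And>n. cmod (a n) \<le> M * r ^ n"
  shows "summable (\<lambda>n. norm (a n *\<^sub>C op_power A n))"
    and "norm (\<Sum>n. a n *\<^sub>C op_power A n) \<le> M * (\<Sum>n. norm (op_power A n) * r ^ n)"
proof -
  have s: "summable (\<lambda>n. M * (norm (op_power A n) * r ^ n))"
    using assms by (intro summable_mult) (auto simp: rapidly_decaying_def)
  have le: "norm (a n *\<^sub>C op_power A n) \<le> M * (norm (op_power A n) * r ^ n)" for n
    using mult_right_mono[OF a[of n], of "norm (op_power A n)"] by (simp add: norm_scaleC mult_ac)
  show 1: "summable (\<lambda>n. norm (a n *\<^sub>C op_power A n))"
    by (rule summable_comparison_test'[OF s]) (use le in simp)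
  have "norm (\<Sum>n. a n *\<^sub>C op_power A n) \<le> (\<Sum>n. norm (a n *\<^sub>C op_power A n))"
    by (rule summable_norm[OF 1])
  also have "\<dots> \<le> (\<Sum>n. M * (norm (op_power A n) * r ^ n))"
    by (rule suminf_le[OF le 1 s])
  also have "\<dots> = M * (\<Sum>n. norm (op_power A n) * r ^ n)"
    using assms by (intro suminf_mult) (auto simp: rapidly_decaying_def)
  finally show "norm (\<Sum>n. a n *\<^sub>C op_power A n) \<le> M * (\<Sum>n. norm (op_power A n) * r ^ n)" .
qed

lemma rapidly_decaying_summable_powers:
  assumes "rapidly_decaying A"
  shows "summable (\<lambda>n. norm (w ^ n *\<^sub>C op_power A n))"
proof (rule rapidly_decaying_summable(1)[OF assms])
  show "0 < cmod w + 1"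
    by (rule add_nonneg_pos) auto
  show "cmod (w ^ n) \<le> 1 * (cmod w + 1) ^ n" for n
    unfolding norm_power mult_1 by (rule power_mono) auto
qed

lemma is_op_inverse_unique:
  assumes "is_op_inverse T B" "is_op_inverse T C"
  shows "B = C"
proof -
  have "B = B o\<^sub>L (T o\<^sub>L C)"
    using assms(2) by (simp add: is_op_inverse_def)
  also have "\<dots> = C"
    using assms(1) by (simp add: is_op_inverse_def blinfun_compose_assoc[symmetric])
  finally show ?thesis .
qed

lemma resolvent_eqI: "is_op_inverse (scalar_op z - A) B \<Longrightarrow> resolvent A z = B"
  unfolding resolvent_def by (rule the_equality) (auto intro: is_op_inverse_unique)

lemma is_op_inverse_neumann:
  assumes A: "clinear_op A" and rd: "rapidly_decaying A"
  shows "is_op_inverse (id_blinfun - w *\<^sub>C A) (\<Sum>n. w ^ n *\<^sub>C op_power A n)"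
proof -
  have sums: "(\<lambda>n. w ^ n *\<^sub>C op_power A n) sums (\<Sum>n. w ^ n *\<^sub>C op_power A n)" (is "_ sums ?S")
    by (rule summable_sums[OF summable_norm_cancel[OF rapidly_decaying_summable_powers[OF rd]]])
  then have lim: "(\<lambda>N. \<Sum>n<N. w ^ n *\<^sub>C op_power A n) \<longlonglongrightarrow> ?S"
    by (simp add: sums_def)
  have lim1: "(\<lambda>N. id_blinfun - w ^ N *\<^sub>C op_power A N) \<longlonglongrightarrow> id_blinfun - 0"
    by (rule tendsto_diff[OF tendsto_const summable_LIMSEQ_zero[OF sums_summable[OF sums]]])
  have geo: "(\<Sum>n<N. w ^ n *\<^sub>C op_power A n) o\<^sub>L (id_blinfun - w *\<^sub>C A) =
    id_blinfun - w ^ N *\<^sub>C op_power A N" for N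
    by (rule op_geometric_sum[OF A])
  have comm: "(id_blinfun - w *\<^sub>C A) o\<^sub>L (\<Sum>n<N. w ^ n *\<^sub>C op_power A n) =
      (\<Sum>n<N. w ^ n *\<^sub>C op_power A n) o\<^sub>L (id_blinfun - w *\<^sub>C A)" for N
  proof -
    have "A o\<^sub>L op_power A n = op_power A n o\<^sub>L A" for n
      by (metis op_power.simps(2) op_power_Suc_right)
    then show ?thesis
      unfolding blinfun_compose.sum_left blinfun_compose.sum_right
      by (intro sum.cong refl)
        (simp add: blinfun_compose.diff_left blinfun_compose.diff_right scaleC_compose_left
          scaleC_compose_right A clinear_op_power scaleC_scaleC mult.commute)
  qed
  have l: "(\<lambda>N. (\<Sum>n<N. w ^ n *\<^sub>C op_power A n) o\<^sub>L (id_blinfun - w *\<^sub>C A)) \<longlonglongrightarrow>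
      (?S o\<^sub>L (id_blinfun - w *\<^sub>C A))"
    by (intro blinfun_compose.tendsto lim tendsto_const)
  have r: "(\<lambda>N. (id_blinfun - w *\<^sub>C A) o\<^sub>L (\<Sum>n<N. w ^ n *\<^sub>C op_power A n)) \<longlonglongrightarrow>
      ((id_blinfun - w *\<^sub>C A) o\<^sub>L ?S)"
    by (intro blinfun_compose.tendsto lim tendsto_const)
  show ?thesis
    using LIMSEQ_unique[OF l[unfolded geo] lim1] LIMSEQ_unique[OF r[unfolded comm geo] lim1]
    by (simp add: is_op_inverse_def)
qed

lemma is_op_inverse_resolvent:
  assumes A: "clinear_op A" and rd: "rapidly_decaying A" and z: "z \<noteq> 0"
  shows "is_op_inverse (scalar_op z - A) (resolvent A z)"
    and "resolvent A z = (1 / z) *\<^sub>C (\<Sum>n. (1 / z) ^ n *\<^sub>C op_power A n)"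
proof -
  have eq: "scalar_op z - A = z *\<^sub>C (id_blinfun - (1 / z) *\<^sub>C A)"
    using z by (simp add: scalar_op_eq_scaleC scaleC.diff_right scaleC_scaleC)
  have "clinear_op (id_blinfun - (1 / z) *\<^sub>C A)"
    using A by (simp add: clinear_op_def blinfun.bilinear_simps scaleC_blinfun_apply
        scaleC_scaleC mult.commute scaleC.diff_right)
  then have inv: "is_op_inverse (scalar_op z - A) ((1 / z) *\<^sub>C (\<Sum>n. (1 / z) ^ n *\<^sub>C op_power A n))"
    unfolding eq by (intro is_op_inverse_scaleC is_op_inverse_neumann assms)
  then show "resolvent A z = (1 / z) *\<^sub>C (\<Sum>n. (1 / z) ^ n *\<^sub>C op_power A n)"
    by (rule resolvent_eqI)
  with inv show "is_op_inverse (scalar_op z - A) (resolvent A z)"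
    by simp
qed

section \<open>The functional calculus as a power series\<close>

text \<open>Term-by-term integration, with the derivative taken in the complex direction: \<open>h\<close> acts by complex
  scaling. It is applied below to both halves of a Laurent expansion of the resolvent integrand.\<close>

lemma power_series_primitive:
  fixes c :: "nat \<Rightarrow> 'b::complex_banach"
  assumes sm: "summable (\<lambda>n. norm (c n) * r ^ n)" and z: "cmod z < r"
  shows "((\<lambda>z. \<Sum>n. (z ^ Suc n / of_nat (Suc n)) *\<^sub>C c n) has_derivative
          (\<lambda>h. h *\<^sub>C (\<Sum>n. z ^ n *\<^sub>C c n))) (at z)"
proof -
  have r: "r > 0" using z norm_ge_zero[of z] by linarith
  have le: "norm (x ^ n *\<^sub>C c n) \<le> norm (c n) * r ^ n" if "x \<in> ball 0 r" for x n
    using that r unfolding norm_scaleC norm_power mult.commute[of "norm (c n)"]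
    by (intro mult_right_mono power_mono) auto
  have nsm: "summable (\<lambda>n. norm (x ^ n *\<^sub>C c n))" if "x \<in> ball 0 r" for x
    by (rule summable_comparison_test'[OF sm]) (use le[OF that] in simp)
  have tail: "norm ((\<Sum>i<n. x ^ i *\<^sub>C c i) - (\<Sum>i. x ^ i *\<^sub>C c i)) \<le> (\<Sum>i. norm (c (i + n)) * r ^ (i + n))"
    if x: "x \<in> ball 0 r" for x n
  proof -
    have "(\<Sum>i<n. x ^ i *\<^sub>C c i) - (\<Sum>i. x ^ i *\<^sub>C c i) = - (\<Sum>i. x ^ (i + n) *\<^sub>C c (i + n))"
      using suminf_split_initial_segment[OF summable_norm_cancel[OF nsm[OF x]], of n] by simp
    moreover have "norm (\<Sum>i. x ^ (i + n) *\<^sub>C c (i + n)) \<le> (\<Sum>i. norm (c (i + n)) * r ^ (i + n))"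
      by (intro norm_suminf_le le x summable_ignore_initial_segment[OF sm])
    ultimately show ?thesis by simp
  qed
  have "\<exists>g. \<forall>x\<in>ball 0 r. (\<lambda>n. (x ^ Suc n / of_nat (Suc n)) *\<^sub>C c n) sums g x \<and>
          (g has_derivative (\<lambda>h. h *\<^sub>C (\<Sum>n. x ^ n *\<^sub>C c n))) (at x within ball 0 r)"
  proof (rule has_derivative_series)
    show "((\<lambda>z. (z ^ Suc n / of_nat (Suc n)) *\<^sub>C c n) has_derivative (\<lambda>h. h *\<^sub>C x ^ n *\<^sub>C c n))
      (at x within ball 0 r)" for n x
    proof -
      have "((\<lambda>z. z ^ Suc n / of_nat (Suc n)) has_field_derivative x ^ n) (at x within ball 0 r)"
      proof -
        have "((\<lambda>z. z ^ Suc n / of_nat (Suc n)) has_field_derivative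
          ((1 + of_nat n) * (1 * x ^ n)) / of_nat (Suc n)) (at x within ball 0 r)"
          by (intro DERIV_cdivide DERIV_power_Suc DERIV_ident)
        moreover have "((1 + of_nat n) * (1 * x ^ n)) / of_nat (Suc n) = x ^ n"
          using of_nat_neq_0[of n, where 'a = complex] by (simp add: field_simps)
        ultimately show ?thesis by simp
      qed
      then have "((\<lambda>z. z ^ Suc n / of_nat (Suc n)) has_derivative (\<lambda>h. x ^ n * h)) (at x within ball 0 r)"
        by (simp add: has_field_derivative_def)
      from bounded_linear.has_derivative[OF scaleC.bounded_linear_left this, of "c n"]
      show ?thesis by (simp add: scaleC_scaleC mult.commute)
    qed
    show "\<forall>\<^sub>F n in sequentially. \<forall>x\<in>ball 0 r. \<forall>h.
        norm ((\<Sum>i<n. h *\<^sub>C x ^ i *\<^sub>C c i) - h *\<^sub>C (\<Sum>n. x ^ n *\<^sub>C c n)) \<le> e * norm h" if "e > 0" for e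
    proof -
      have "(\<lambda>n. \<Sum>i. norm (c (i + n)) * r ^ (i + n)) \<longlonglongrightarrow> 0"
        using suminf_exist_split2[OF sm] .
      then have "\<forall>\<^sub>F n in sequentially. (\<Sum>i. norm (c (i + n)) * r ^ (i + n)) < e"
        using that by (rule order_tendstoD)
      then show ?thesis
      proof eventually_elim
        case (elim n)
        show ?case
        proof (intro ballI allI)
          fix x h :: complex assume x: "x \<in> ball 0 r"
          have "(\<Sum>i<n. h *\<^sub>C x ^ i *\<^sub>C c i) - h *\<^sub>C (\<Sum>n. x ^ n *\<^sub>C c n) =
             h *\<^sub>C ((\<Sum>i<n. x ^ i *\<^sub>C c i) - (\<Sum>n. x ^ n *\<^sub>C c n))"
            by (simp add: scaleC.sum_right scaleC.diff_right)
          also have "norm \<dots> \<le> norm h * e"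
            unfolding norm_scaleC using tail[OF x, of n] elim by (intro mult_left_mono) auto
          finally show "norm ((\<Sum>i<n. h *\<^sub>C x ^ i *\<^sub>C c i) - h *\<^sub>C (\<Sum>n. x ^ n *\<^sub>C c n)) \<le> e * norm h"
            by (simp add: mult.commute)
        qed
      qed
    qed
    show "(0::complex) \<in> ball 0 r" using r by simp
    show "(\<lambda>n. (0 ^ Suc n / of_nat (Suc n)) *\<^sub>C c n) sums 0" by simp
  qed simp
  then obtain g where g: "\<And>x. x \<in> ball 0 r \<Longrightarrow> (\<lambda>n. (x ^ Suc n / of_nat (Suc n)) *\<^sub>C c n) sums g x"
    and g': "\<And>x. x \<in> ball 0 r \<Longrightarrow>
       (g has_derivative (\<lambda>h. h *\<^sub>C (\<Sum>n. x ^ n *\<^sub>C c n))) (at x within ball 0 r)"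
    by blast
  have zr: "z \<in> ball 0 r" using z by simp
  then have "(g has_derivative (\<lambda>h. h *\<^sub>C (\<Sum>n. z ^ n *\<^sub>C c n))) (at z)"
    using g'[OF zr] by (simp only: at_within_open[OF zr open_ball])
  then show ?thesis
    by (rule has_derivative_transform_within_open[OF _ open_ball zr]) (rule sums_unique[OF g])
qed

definition taylor_coeff :: "(complex \<Rightarrow> complex) \<Rightarrow> nat \<Rightarrow> complex" where
  "taylor_coeff g n = (deriv ^^ n) g 0 / fact n"

definition series_calculus ::
    "(complex \<Rightarrow> complex) \<Rightarrow> ('a::complex_banach \<Rightarrow>\<^sub>L 'a) \<Rightarrow> ('a \<Rightarrow>\<^sub>L 'a)" where
  "series_calculus g A = (\<Sum>n. taylor_coeff g n *\<^sub>C op_power A n)"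

lemma taylor_coeff_bound:
  assumes "g holomorphic_on cball 0 r" "0 < r" "\<And>z. cmod z = r \<Longrightarrow> cmod (g z) \<le> M"
  shows "cmod (taylor_coeff g n) \<le> M * (1 / r) ^ n"
proof -
  have "cmod ((deriv ^^ n) g 0) \<le> fact n * M / r ^ n"
    using assms by (intro Cauchy_inequality)
      (auto intro: holomorphic_on_imp_continuous_on holomorphic_on_subset)
  then show ?thesis
    by (simp add: taylor_coeff_def norm_divide power_divide field_simps)
qed

lemma taylor_coeff_bounded:
  assumes "g holomorphic_on cball 0 r" "0 < r"
  obtains M where "\<And>n. cmod (taylor_coeff g n) \<le> M * (1 / r) ^ n"
proof -
  have "compact (g ` cball 0 r)"
    using assms by (intro compact_continuous_image holomorphic_on_imp_continuous_on) auto
  then obtain M where "\<And>z. z \<in> cball 0 r \<Longrightarrow> cmod (g z) \<le> M"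
    by (meson bounded_iff compact_imp_bounded image_eqI)
  then show ?thesis
    using taylor_coeff_bound[OF assms, of M] that by auto
qed

text \<open>With \<open>f(z) = \<Sum> a\<^sub>n z\<^sup>n\<close>, the difference quotient \<open>(f(z) - f(A)) (z - A)\<^sup>-\<^sup>1\<close> has no singularity at
  \<open>0\<close>: it is the power series with coefficients \<open>q\<^sub>j\<^sub>+\<^sub>1\<close>, where \<open>q\<^sub>j = \<Sum>\<^sub>n a\<^sub>n\<^sub>+\<^sub>j A\<^sup>n\<close>. The recursion
  \<open>q\<^sub>j = a\<^sub>j + A q\<^sub>j\<^sub>+\<^sub>1\<close> makes its product with \<open>z - A\<close> telescope.\<close>

lemma resolvent_splitting:
  fixes A :: "'a::complex_banach \<Rightarrow>\<^sub>L 'a"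
  assumes A: "clinear_op A" and rd: "rapidly_decaying A"
    and hol: "f holomorphic_on cball 0 s" and s: "0 < s"
  defines "q \<equiv> \<lambda>j. \<Sum>n. taylor_coeff f (n + j) *\<^sub>C op_power A n"
  shows "r < s \<Longrightarrow> 0 \<le> r \<Longrightarrow> summable (\<lambda>j. norm (q (Suc j)) * r ^ j)"
    and "z \<noteq> 0 \<Longrightarrow> cmod z < s \<Longrightarrow>
      f z *\<^sub>C resolvent A z = (\<Sum>j. z ^ j *\<^sub>C q (Suc j)) + (resolvent A z o\<^sub>L series_calculus f A)"
proof -
  obtain M where M: "\<And>n. cmod (taylor_coeff f n) \<le> M * (1 / s) ^ n"
    using taylor_coeff_bounded[OF hol s] by blast
  define C where "C = M * (\<Sum>n. norm (op_power A n) * (1 / s) ^ n)"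
  have M': "cmod (taylor_coeff f (n + j)) \<le> M * (1 / s) ^ j * (1 / s) ^ n" for n j
    using M[of "n + j"] by (simp add: power_add mult_ac)
  have summ: "summable (\<lambda>n. taylor_coeff f (n + j) *\<^sub>C op_power A n)" for j
    by (rule summable_norm_cancel[OF rapidly_decaying_summable(1)[OF rd _ M']]) (use s in simp)
  have q_bound: "norm (q j) \<le> C * (1 / s) ^ j" for j
    using rapidly_decaying_summable(2)[OF rd _ M'] s by (simp add: q_def C_def mult_ac)
  show sum_q: "summable (\<lambda>j. norm (q (Suc j)) * r ^ j)" if "r < s" "0 \<le> r" for r
  proof (rule summable_comparison_test'[of "\<lambda>j. C * (1 / s) * (r / s) ^ j"])
    show "summable (\<lambda>j. C * (1 / s) * (r / s) ^ j)"
      using that s by (intro summable_mult summable_geometric) auto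
    show "norm (norm (q (Suc j)) * r ^ j) \<le> C * (1 / s) * (r / s) ^ j" for j
      using mult_right_mono[OF q_bound[of "Suc j"], of "r ^ j"] that
      by (simp add: power_divide mult_ac)
  qed
  have q_rec: "q j = taylor_coeff f j *\<^sub>C id_blinfun + (A o\<^sub>L q (Suc j))" for j
  proof -
    have "q j = taylor_coeff f j *\<^sub>C id_blinfun + (\<Sum>n. taylor_coeff f (Suc n + j) *\<^sub>C op_power A (Suc n))"
      using suminf_split_head[OF summ[of j]] by (simp add: q_def)
    also have "(\<Sum>n. taylor_coeff f (Suc n + j) *\<^sub>C op_power A (Suc n)) =
       (\<Sum>n. A o\<^sub>L (taylor_coeff f (n + Suc j) *\<^sub>C op_power A n))"
      by (simp add: scaleC_compose_right[OF A])
    also have "\<dots> = A o\<^sub>L q (Suc j)"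
      unfolding q_def by (rule bounded_linear.suminf[OF blinfun_compose.bounded_linear_right summ, symmetric])
    finally show ?thesis .
  qed
  assume z: "z \<noteq> 0" "cmod z < s"
  let ?E = "series_calculus f A"
  have E: "?E = q 0" by (simp add: series_calculus_def q_def)
  have partial: "(scalar_op z - A) o\<^sub>L (\<Sum>j<N. z ^ j *\<^sub>C q (Suc j)) =
    z ^ N *\<^sub>C q N - q 0 + (\<Sum>j<N. taylor_coeff f j * z ^ j) *\<^sub>C id_blinfun" for N
  proof (induction N)
    case (Suc N)
    have "A o\<^sub>L q (Suc N) = q N - taylor_coeff f N *\<^sub>C id_blinfun"
      using q_rec[of N] by simp
    then have "(scalar_op z - A) o\<^sub>L (z ^ N *\<^sub>C q (Suc N)) =
       z ^ Suc N *\<^sub>C q (Suc N) - z ^ N *\<^sub>C q N + (taylor_coeff f N * z ^ N) *\<^sub>C id_blinfun"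
      by (simp add: blinfun_compose.diff_left scalar_op_compose scaleC_compose_right[OF A]
          scaleC_scaleC scaleC.diff_right mult.commute)
    then show ?case
      using Suc by (simp add: blinfun_compose.add_right scaleC.add_left)
  qed simp
  have lim_q: "(\<lambda>N. z ^ N *\<^sub>C q N) \<longlonglongrightarrow> 0"
  proof (rule Lim_null_comparison)
    show "\<forall>\<^sub>F N in sequentially. norm (z ^ N *\<^sub>C q N) \<le> C * (cmod z / s) ^ N"
      using mult_left_mono[OF q_bound, of "cmod z ^ _"]
      by (intro always_eventually allI) (simp add: norm_scaleC norm_power power_divide mult_ac)
    show "(\<lambda>N. C * (cmod z / s) ^ N) \<longlonglongrightarrow> 0"
      using z s by (intro tendsto_mult_right_zero LIMSEQ_power_zero) auto
  qed
  have lim_f: "(\<lambda>N. \<Sum>j<N. taylor_coeff f j * z ^ j) \<longlonglongrightarrow> f z"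
    using holomorphic_power_series[of f 0 s z] z hol holomorphic_on_subset[OF hol ball_subset_cball]
    by (simp add: taylor_coeff_def sums_def)
  have lim1: "(\<lambda>N. (scalar_op z - A) o\<^sub>L (\<Sum>j<N. z ^ j *\<^sub>C q (Suc j))) \<longlonglongrightarrow>
      0 - q 0 + f z *\<^sub>C id_blinfun"
    unfolding partial
    by (intro tendsto_add tendsto_diff scaleC.tendsto lim_q lim_f tendsto_const)
  have "summable (\<lambda>j. norm (z ^ j *\<^sub>C q (Suc j)))"
    using sum_q[of "cmod z"] z by (simp add: norm_scaleC norm_power mult.commute)
  then have "(\<lambda>N. \<Sum>j<N. z ^ j *\<^sub>C q (Suc j)) \<longlonglongrightarrow> (\<Sum>j. z ^ j *\<^sub>C q (Suc j))"
    by (rule summable_LIMSEQ[OF summable_norm_cancel])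
  then have lim2: "(\<lambda>N. (scalar_op z - A) o\<^sub>L (\<Sum>j<N. z ^ j *\<^sub>C q (Suc j))) \<longlonglongrightarrow>
      ((scalar_op z - A) o\<^sub>L (\<Sum>j. z ^ j *\<^sub>C q (Suc j)))"
    by (intro blinfun_compose.tendsto tendsto_const)
  have "(scalar_op z - A) o\<^sub>L (\<Sum>j. z ^ j *\<^sub>C q (Suc j)) = f z *\<^sub>C id_blinfun - ?E"
    using LIMSEQ_unique[OF lim2 lim1] E by simp
  then have eq: "resolvent A z o\<^sub>L ((scalar_op z - A) o\<^sub>L (\<Sum>j. z ^ j *\<^sub>C q (Suc j))) =
     (resolvent A z o\<^sub>L (f z *\<^sub>C id_blinfun)) - (resolvent A z o\<^sub>L ?E)"
    by (simp add: blinfun_compose.diff_right)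
  have inv: "is_op_inverse (scalar_op z - A) (resolvent A z)"
    by (rule is_op_inverse_resolvent[OF A rd z(1)])
  have "clinear_op (scalar_op z - A)"
    using A by (simp add: clinear_op_def scalar_op_apply blinfun.bilinear_simps
          scaleC_scaleC mult.commute scaleC.diff_right)
  then have "clinear_op (resolvent A z)"
    using inv by (rule clinear_op_inverse)
  then show "f z *\<^sub>C resolvent A z = (\<Sum>j. z ^ j *\<^sub>C q (Suc j)) + (resolvent A z o\<^sub>L ?E)"
    using eq inv
    by (simp add: blinfun_compose_assoc[symmetric] is_op_inverse_def scaleC_compose_right)
qed

text \<open>After the splitting, the regular part has a primitive by the power series in \<open>z\<close>, and the singular
  part \<open>((z - A)\<^sup>-\<^sup>1 - z\<^sup>-\<^sup>1) f(A)\<close> has one by a power series in \<open>1/z\<close>. Only the term \<open>z\<^sup>-\<^sup>1 f(A)\<close> lacks a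
  primitive.\<close>

lemma resolvent_primitive:
  fixes A :: "'a::complex_banach \<Rightarrow>\<^sub>L 'a"
  assumes A: "clinear_op A" and rd: "rapidly_decaying A"
    and hol: "f holomorphic_on cball 0 s" and s: "0 < s"
  obtains H where "\<And>z. z \<noteq> 0 \<Longrightarrow> cmod z < s \<Longrightarrow>
    (H has_derivative (\<lambda>h. h *\<^sub>C (f z *\<^sub>C resolvent A z - (1 / z) *\<^sub>C series_calculus f A))) (at z)"
proof
  let ?E = "series_calculus f A"
  define q where "q j = (\<Sum>n. taylor_coeff f (n + j) *\<^sub>C op_power A n)" for j
  define P where "P z = (\<Sum>n. (z ^ Suc n / of_nat (Suc n)) *\<^sub>C q (Suc n))" for z
  define L where "L w = (\<Sum>n. (w ^ Suc n / of_nat (Suc n)) *\<^sub>C op_power A (Suc n))" for w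
  fix z assume z: "z \<noteq> 0" "cmod z < s"
  define Q where "Q = (\<Sum>n. z ^ n *\<^sub>C q (Suc n))"
  define N where "N = (\<Sum>n. (1 / z) ^ n *\<^sub>C op_power A (Suc n))"
  obtain r where r: "cmod z < r" "r < s" using z dense by blast
  have "summable (\<lambda>n. norm (q (Suc n)) * r ^ n)"
    unfolding q_def by (rule resolvent_splitting(1)[OF A rd hol s]) (use r norm_ge_zero[of z] in linarith)+
  from power_series_primitive[OF this r(1)]
  have P: "(P has_derivative (\<lambda>h. h *\<^sub>C Q)) (at z)"
    unfolding P_def Q_def .
  have "summable (\<lambda>n. norm (op_power A n) * (cmod (1 / z) + 1) ^ n)"
    using rd by (simp add: rapidly_decaying_def add_nonneg_pos)
  then have "summable (\<lambda>n. norm (op_power A (Suc n)) * (cmod (1 / z) + 1) ^ Suc n)"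
    by (subst summable_Suc_iff)
  then have "summable (\<lambda>n. (cmod (1 / z) + 1) * (norm (op_power A (Suc n)) * (cmod (1 / z) + 1) ^ n))"
    by (simp only: power_Suc mult.left_commute)
  then have sumL: "summable (\<lambda>n. norm (op_power A (Suc n)) * (cmod (1 / z) + 1) ^ n)"
    by (rule summable_mult_D) (simp add: add_nonneg_eq_0_iff)
  have "(L has_derivative (\<lambda>h. h *\<^sub>C N)) (at (1 / z))"
    unfolding L_def N_def by (rule power_series_primitive[OF sumL]) simp
  moreover have "((\<lambda>z. 1 / z) has_derivative (\<lambda>h. h * (- 1 / z\<^sup>2))) (at z)"
    using z by (auto intro!: derivative_eq_intros simp: power2_eq_square)
  ultimately have "((\<lambda>z. L (1 / z)) has_derivative (\<lambda>h. (h * (- 1 / z\<^sup>2)) *\<^sub>C N)) (at z)"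
    by (rule has_derivative_compose[rotated])
  then have L: "((\<lambda>z. L (1 / z) o\<^sub>L ?E) has_derivative (\<lambda>h. ((h * (- 1 / z\<^sup>2)) *\<^sub>C N) o\<^sub>L ?E)) (at z)"
    by (rule bounded_linear.has_derivative[OF blinfun_compose.bounded_linear_left])
  have "resolvent A z = (1 / z) *\<^sub>C (id_blinfun + (1 / z) *\<^sub>C N)"
  proof -
    note sm = summable_norm_cancel[OF rapidly_decaying_summable_powers[OF rd, of "1 / z"]]
    have "summable (\<lambda>n. norm ((1 / z) ^ n *\<^sub>C op_power A (Suc n)))"
      by (rule summable_comparison_test'[OF sumL])
        (auto simp: norm_scaleC norm_power mult.commute simp del: norm_divide op_power.simps
            intro!: mult_left_mono power_mono)
    from bounded_linear.suminf[OF scaleC.bounded_linear_right summable_norm_cancel[OF this], of "1 / z"]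
    have "(\<Sum>n. (1 / z) ^ Suc n *\<^sub>C op_power A (Suc n)) = (1 / z) *\<^sub>C N"
      by (simp add: N_def scaleC_scaleC)
    with suminf_split_head[OF sm]
    have "(\<Sum>n. (1 / z) ^ n *\<^sub>C op_power A n) = id_blinfun + (1 / z) *\<^sub>C N"
      by (simp add: algebra_simps)
    then show ?thesis
      using is_op_inverse_resolvent(2)[OF A rd z(1)] by simp
  qed
  then have "resolvent A z o\<^sub>L ?E = (1 / z) *\<^sub>C ?E + (1 / z\<^sup>2) *\<^sub>C (N o\<^sub>L ?E)"
    by (simp add: scaleC_compose_left blinfun_compose.add_left scaleC.add_right scaleC_scaleC
        power2_eq_square)
  moreover have "f z *\<^sub>C resolvent A z = Q + (resolvent A z o\<^sub>L ?E)"
    unfolding Q_def q_def by (rule resolvent_splitting(2)[OF A rd hol s z])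
  ultimately have eq: "f z *\<^sub>C resolvent A z - (1 / z) *\<^sub>C ?E = Q + (1 / z\<^sup>2) *\<^sub>C (N o\<^sub>L ?E)"
    by simp
  have "(\<lambda>h. h *\<^sub>C (f z *\<^sub>C resolvent A z - (1 / z) *\<^sub>C ?E)) =
      (\<lambda>h. h *\<^sub>C Q - (((h * (- 1 / z\<^sup>2)) *\<^sub>C N) o\<^sub>L ?E))"
    unfolding eq by (rule ext)
      (simp add: scaleC.add_right scaleC_scaleC scaleC_compose_left scaleC.minus_left
        blinfun_compose.minus_left)
  then show "((\<lambda>z. P z - (L (1 / z) o\<^sub>L ?E)) has_derivative
     (\<lambda>h. h *\<^sub>C (f z *\<^sub>C resolvent A z - (1 / z) *\<^sub>C ?E))) (at z)"
    using has_derivative_diff[OF P L] by simp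
qed

text \<open>The fundamental theorem of calculus tolerates a finite exceptional set and an unbounded
  derivative in between, so the length of the path is irrelevant. The remaining term \<open>z\<^sup>-\<^sup>1 f(A)\<close>
  contributes the winding number.\<close>

lemma op_contour_integral_resolvent:
  fixes A :: "'a::complex_banach \<Rightarrow>\<^sub>L 'a"
  assumes A: "clinear_op A" and rd: "rapidly_decaying A"
    and hol: "f holomorphic_on cball 0 s" and s: "0 < s"
    and \<gamma>: "valid_path \<gamma>" "pathfinish \<gamma> = pathstart \<gamma>" "path_image \<gamma> \<subseteq> ball 0 s - {0}"
    and w: "winding_number \<gamma> 0 = 1"
  shows "op_contour_integral \<gamma> (\<lambda>z. scalar_op (f z) o\<^sub>L resolvent A z) =
     (2 * of_real pi * \<i>) *\<^sub>C series_calculus f A"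
proof -
  let ?E = "series_calculus f A"
  let ?d = "\<lambda>t. vector_derivative \<gamma> (at t within {0..1})"
  obtain H where H: "\<And>z. z \<noteq> 0 \<Longrightarrow> cmod z < s \<Longrightarrow>
    (H has_derivative (\<lambda>h. h *\<^sub>C (f z *\<^sub>C resolvent A z - (1 / z) *\<^sub>C ?E))) (at z)"
    using resolvent_primitive[OF A rd hol s] by blast
  have im: "\<gamma> t \<noteq> 0" "cmod (\<gamma> t) < s" if "t \<in> {0..1}" for t
    using \<gamma>(3) that by (auto simp: path_image_def image_subset_iff)
  obtain S D where S: "finite S" and D: "\<And>t. t \<in> {0..1} - S \<Longrightarrow> (\<gamma> has_vector_derivative D t) (at t)"
    using \<gamma>(1) unfolding valid_path_def piecewise_C1_differentiable_on_def C1_differentiable_on_def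
    by metis
  have "((\<lambda>t. ?d t *\<^sub>C (f (\<gamma> t) *\<^sub>C resolvent A (\<gamma> t) - (1 / \<gamma> t) *\<^sub>C ?E)) has_integral
     (H (\<gamma> 1) - H (\<gamma> 0))) {0..1}"
  proof (rule fundamental_theorem_of_calculus_interior_strong[OF S])
    fix t :: real assume t: "t \<in> {0<..<1} - S"
    have \<gamma>': "(\<gamma> has_vector_derivative D t) (at t)"
      using D t by auto
    then have d: "?d t = D t"
      using t by (intro vector_derivative_at_within_ivl) auto
    have "((\<lambda>t. H (\<gamma> t)) has_derivative
       (\<lambda>x. (x *\<^sub>R D t) *\<^sub>C (f (\<gamma> t) *\<^sub>C resolvent A (\<gamma> t) - (1 / \<gamma> t) *\<^sub>C ?E))) (at t)"
      using \<gamma>' H im[of t] t unfolding has_vector_derivative_def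
      by (intro has_derivative_compose[of \<gamma> "\<lambda>x. x *\<^sub>R D t" t UNIV H]) auto
    then show "((\<lambda>t. H (\<gamma> t)) has_vector_derivative
       ?d t *\<^sub>C (f (\<gamma> t) *\<^sub>C resolvent A (\<gamma> t) - (1 / \<gamma> t) *\<^sub>C ?E)) (at t)"
      unfolding has_vector_derivative_def d by (simp only: scaleC.scaleR_left)
  next
    have "continuous_on (ball 0 s - {0}) H"
      using H by (intro continuous_at_imp_continuous_on ballI has_derivative_continuous) auto
    moreover have "continuous_on {0..1} \<gamma>"
      using valid_path_imp_path[OF \<gamma>(1)] by (simp only: path_def)
    ultimately show "continuous_on {0..1} (\<lambda>t. H (\<gamma> t))"
      by (rule continuous_on_compose2) (use im in \<open>simp add: image_subset_iff\<close>)
  qed simp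
  moreover have "H (\<gamma> 1) = H (\<gamma> 0)"
    using \<gamma>(2) by (simp add: pathfinish_def pathstart_def)
  ultimately have 1: "((\<lambda>t. ?d t *\<^sub>C (f (\<gamma> t) *\<^sub>C resolvent A (\<gamma> t) - (1 / \<gamma> t) *\<^sub>C ?E)) has_integral 0) {0..1}"
    by simp
  have "((\<lambda>z. 1 / (z - 0)) has_contour_integral (2 * of_real pi * \<i> * winding_number \<gamma> 0)) \<gamma>"
    using has_contour_integral_winding_number[OF \<gamma>(1), of 0] \<gamma>(3) by auto
  then have "((\<lambda>t. 1 / \<gamma> t * ?d t) has_integral (2 * of_real pi * \<i>)) {0..1}"
    using w by (simp add: has_contour_integral_def)
  from has_integral_linear[OF this scaleC.bounded_linear_left[of ?E]]
  have 2: "((\<lambda>t. (1 / \<gamma> t * ?d t) *\<^sub>C ?E) has_integral (2 * of_real pi * \<i>) *\<^sub>C ?E) {0..1}"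
    by (simp add: o_def)
  have "((\<lambda>t. ?d t *\<^sub>C f (\<gamma> t) *\<^sub>C resolvent A (\<gamma> t)) has_integral (2 * of_real pi * \<i>) *\<^sub>C ?E) {0..1}"
    using has_integral_add[OF 1 2] by (simp add: scaleC.diff_right scaleC_scaleC mult.commute)
  then show ?thesis
    unfolding op_contour_integral_def scalar_op_compose by (rule integral_unique)
qed

text \<open>The point \<open>0\<close> belongs to the spectrum, since otherwise \<open>A\<^sup>n\<close> could decay at most geometrically. On
  the zero space this fails: every operator is invertible there.\<close>

lemma spectrum_rapidly_decaying:
  fixes A :: "'a::complex_banach \<Rightarrow>\<^sub>L 'a"
  assumes rd: "rapidly_decaying A" and A: "clinear_op A" and nontriv: "(id_blinfun :: 'a \<Rightarrow>\<^sub>L 'a) \<noteq> 0"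
  shows "spectrum A = {0}"
proof -
  have "0 \<in> spectrum A"
  proof (rule ccontr)
    assume "0 \<notin> spectrum A"
    then obtain B where "is_op_inverse (- A) B"
      by (auto simp: spectrum_def scalar_op_eq_scaleC)
    then have AB: "(- B) o\<^sub>L A = id_blinfun"
      by (simp add: is_op_inverse_def blinfun_compose.minus_left blinfun_compose.minus_right)
    have inv: "op_power (- B) n o\<^sub>L op_power A n = id_blinfun" for n
    proof (induction n)
      case (Suc n)
      have "op_power (- B) (Suc n) o\<^sub>L op_power A (Suc n) =
         op_power (- B) n o\<^sub>L ((- B) o\<^sub>L A) o\<^sub>L op_power A n"
        unfolding op_power_Suc_right[of "- B"] by (simp add: blinfun_compose_assoc)
      then show ?case unfolding AB using Suc by simp
    qed simp
    have le: "norm (id_blinfun :: 'a \<Rightarrow>\<^sub>L 'a) \<le> norm (op_power A n) * (norm B + 1) ^ n" for n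
    proof -
      have "norm (id_blinfun :: 'a \<Rightarrow>\<^sub>L 'a) \<le> norm (op_power (- B) n) * norm (op_power A n)"
        using norm_blinfun_compose[of "op_power (- B) n" "op_power A n"] unfolding inv .
      also have "\<dots> \<le> (norm B + 1) ^ n * norm (op_power A n)"
        using norm_op_power_le[of "- B" n]
        by (intro mult_right_mono order_trans[OF norm_op_power_le]) (auto intro!: power_mono)
      finally show ?thesis by (simp add: mult.commute)
    qed
    have "summable (\<lambda>n. norm (op_power A n) * (norm B + 1) ^ n)"
      using rd by (simp add: rapidly_decaying_def add_nonneg_pos)
    then have "(\<lambda>n. norm (op_power A n) * (norm B + 1) ^ n) \<longlonglongrightarrow> 0"
      by (rule summable_LIMSEQ_zero)
    then have "norm (id_blinfun :: 'a \<Rightarrow>\<^sub>L 'a) \<le> 0"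
      by (rule LIMSEQ_le_const) (use le in auto)
    with nontriv show False by simp
  qed
  moreover have "z \<notin> spectrum A" if "z \<noteq> 0" for z
    using is_op_inverse_resolvent(1)[OF A rd that] by (auto simp: spectrum_def)
  ultimately show ?thesis by auto
qed

text \<open>Circles around \<open>0\<close> show that admissible contours exist. The chosen contour is an arbitrary one,
  and by compactness it stays inside a closed disk on which \<open>f\<close> is holomorphic.\<close>

lemma riesz_dunford_eq_series_calculus:
  fixes A :: "'a::complex_banach \<Rightarrow>\<^sub>L 'a"
  assumes A: "clinear_op A" and rd: "rapidly_decaying A"
    and nontriv: "(id_blinfun :: 'a \<Rightarrow>\<^sub>L 'a) \<noteq> 0"
    and R: "0 < R" and hol: "f holomorphic_on eball 0 R"
  shows "riesz_dunford R f A = series_calculus f A"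
proof -
  have sp: "spectrum A = {0}"
    by (rule spectrum_rapidly_decaying[OF rd A nontriv])
  obtain r where r: "0 < ereal r" "ereal r < R"
    using R ereal_dense2 by blast
  have "spectral_contour R A (circlepath 0 r)"
    using r by (auto simp: spectral_contour_def sp winding_number_circlepath)
  then have "spectral_contour R A (SOME \<gamma>. spectral_contour R A \<gamma>)"
    by (rule someI[where P = "spectral_contour R A"])
  then obtain \<gamma> where \<gamma>_def: "\<gamma> = (SOME \<gamma>. spectral_contour R A \<gamma>)" and \<gamma>: "spectral_contour R A \<gamma>"
    by blast
  have \<gamma>': "valid_path \<gamma>" "pathfinish \<gamma> = pathstart \<gamma>" "path_image \<gamma> \<subseteq> eball 0 R - {0}"
    "winding_number \<gamma> 0 = 1"
    using \<gamma> by (auto simp: spectral_contour_def sp)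
  have "compact (path_image \<gamma>)" "path_image \<gamma> \<noteq> {}"
    using \<gamma>'(1) by (auto intro: compact_path_image valid_path_imp_path)
  then obtain z where z: "z \<in> path_image \<gamma>" "\<And>y. y \<in> path_image \<gamma> \<Longrightarrow> cmod y \<le> cmod z"
    using continuous_attains_sup[of "path_image \<gamma>" cmod] continuous_on_norm_id by blast
  then have "ereal (cmod z) < R"
    using \<gamma>'(3) by auto
  then obtain s where s: "cmod z < s" "ereal s < R"
    using ereal_dense2 by (metis less_ereal.simps(1))
  then have s0: "0 < s" using norm_ge_zero[of z] by linarith
  have "cball 0 s \<subseteq> eball (0::complex) R"
  proof
    fix x :: complex assume "x \<in> cball 0 s"
    then have "ereal (cmod x) \<le> ereal s" by simp
    also note s(2)
    finally show "x \<in> eball 0 R" by simp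
  qed
  then have "f holomorphic_on cball 0 s"
    by (rule holomorphic_on_subset[OF hol])
  moreover have "path_image \<gamma> \<subseteq> ball 0 s - {0}"
    using z s \<gamma>'(3) by force
  ultimately have "op_contour_integral \<gamma> (\<lambda>z. scalar_op (f z) o\<^sub>L resolvent A z) =
     (2 * of_real pi * \<i>) *\<^sub>C series_calculus f A"
    using \<gamma>' s0 by (intro op_contour_integral_resolvent[OF A rd])
  then show ?thesis
    unfolding riesz_dunford_def \<gamma>_def[symmetric] by (simp add: scalar_op_compose scaleC_scaleC)
qed

section \<open>The power series calculus is multiplicative\<close>

lemma uniform_limit_taylor:
  assumes hol: "g holomorphic_on ball 0 r" and \<rho>: "\<rho> < r"
  shows "uniform_limit (cball 0 \<rho>) (\<lambda>N z. \<Sum>n<N. taylor_coeff g n * z ^ n) g sequentially"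
proof (cases "0 \<le> \<rho>")
  case True
  obtain s where s: "\<rho> < s" "s < r" using \<rho> dense by blast
  then have s0: "0 < s" using True by simp
  have "g holomorphic_on cball 0 s"
    using s by (intro holomorphic_on_subset[OF hol]) auto
  then obtain M where M: "\<And>n. cmod (taylor_coeff g n) \<le> M * (1 / s) ^ n"
    using taylor_coeff_bounded s0 by blast
  have "uniform_limit (cball 0 \<rho>) (\<lambda>N z. \<Sum>n<N. taylor_coeff g n * z ^ n)
     (\<lambda>z. \<Sum>n. taylor_coeff g n * z ^ n) sequentially"
  proof (rule Weierstrass_m_test)
    show "summable (\<lambda>n. M * (\<rho> / s) ^ n)"
      using s True by (intro summable_mult summable_geometric) auto
    fix n and z :: complex assume z: "z \<in> cball 0 \<rho>"
    have "norm (taylor_coeff g n * z ^ n) \<le> (M * (1 / s) ^ n) * \<rho> ^ n"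
      unfolding norm_mult norm_power
      by (rule mult_mono[OF M power_mono]) (use z in \<open>auto intro: order_trans[OF norm_ge_zero M]\<close>)
    then show "norm (taylor_coeff g n * z ^ n) \<le> M * (\<rho> / s) ^ n"
      by (simp add: power_divide)
  qed
  moreover have "(\<Sum>n. taylor_coeff g n * z ^ n) = g z" if "z \<in> cball 0 \<rho>" for z
    using holomorphic_power_series[OF hol, of z] that \<rho>
    by (simp add: taylor_coeff_def sums_iff)
  ultimately show ?thesis
    by (subst uniform_limit_cong'[where g = "\<lambda>N z. \<Sum>n<N. taylor_coeff g n * z ^ n"
          and i = "\<lambda>z. \<Sum>n. taylor_coeff g n * z ^ n"]) auto
next
  case False
  then have "cball (0::complex) \<rho> = {}" by simp
  then show ?thesis by simp
qed

lemma taylor_coeff_eq_fps_nth: "g has_fps_expansion G \<Longrightarrow> taylor_coeff g n = fps_nth G n"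
  by (simp add: taylor_coeff_def fps_nth_fps_expansion)

lemma has_fps_expansion_ball:
  "0 < r \<Longrightarrow> g holomorphic_on ball 0 r \<Longrightarrow> g has_fps_expansion fps_expansion g 0"
  by (rule has_fps_expansion_fps_expansion[of "ball 0 r"]) auto

context
  fixes A :: "'a::complex_banach \<Rightarrow>\<^sub>L 'a"
  assumes A: "clinear_op A" and rd: "rapidly_decaying A"
begin

lemma summable_series_calculus:
  assumes "0 < r" "g holomorphic_on ball 0 r"
  shows "summable (\<lambda>n. taylor_coeff g n *\<^sub>C op_power A n)"
proof -
  have "g holomorphic_on cball 0 (r / 2)"
    using assms(1) by (intro holomorphic_on_subset[OF assms(2)]) auto
  then obtain M where M: "\<And>n. cmod (taylor_coeff g n) \<le> M * (1 / (r / 2)) ^ n"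
    using taylor_coeff_bounded[of g "r / 2"] assms(1) by auto
  show ?thesis
    by (rule summable_norm_cancel[OF rapidly_decaying_summable(1)[OF rd _ M]]) (use assms in simp)
qed

lemma series_calculus_cong:
  assumes "0 < r" "g holomorphic_on ball 0 r" "\<And>z. z \<in> ball 0 r \<Longrightarrow> g z = h z"
  shows "series_calculus g A = series_calculus h A"
proof -
  have "h holomorphic_on ball 0 r"
    by (rule holomorphic_transform[OF assms(2,3)])
  then have "(deriv ^^ n) g 0 = (deriv ^^ n) h 0" for n
    using assms by (intro higher_deriv_transform_within_open[of g "ball 0 r"]) auto
  then show ?thesis by (simp add: series_calculus_def taylor_coeff_def)
qed

lemma series_calculus_add:
  assumes "0 < r" "g holomorphic_on ball 0 r" "h holomorphic_on ball 0 r"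
  shows "series_calculus (\<lambda>z. g z + h z) A = series_calculus g A + series_calculus h A"
proof -
  have "taylor_coeff (\<lambda>z. g z + h z) n = taylor_coeff g n + taylor_coeff h n" for n
    using assms
    by (simp add: taylor_coeff_def higher_deriv_add[of g "ball 0 r"] add_divide_distrib)
  then show ?thesis
    unfolding series_calculus_def
    using suminf_add[OF summable_series_calculus[OF assms(1,2)] summable_series_calculus[OF assms(1,3)]]
    by (simp add: scaleC_add_left)
qed

lemma series_calculus_cmult:
  assumes "0 < r" "g holomorphic_on ball 0 r"
  shows "series_calculus (\<lambda>z. c * g z) A = c *\<^sub>C series_calculus g A"
proof -
  have "taylor_coeff (\<lambda>z. c * g z) n = c * taylor_coeff g n" for n
    using has_fps_expansion_cmult_left[OF has_fps_expansion_ball[OF assms], of c]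
      has_fps_expansion_ball[OF assms]
    by (simp add: taylor_coeff_eq_fps_nth)
  then show ?thesis
    unfolding series_calculus_def
    using bounded_linear.suminf[OF scaleC.bounded_linear_right summable_series_calculus[OF assms], of c]
    by (simp add: scaleC_scaleC)
qed

lemma series_calculus_one: "series_calculus (\<lambda>z. 1) A = id_blinfun"
proof -
  have "taylor_coeff (\<lambda>z. 1) n *\<^sub>C op_power A n = (if n = 0 then id_blinfun else 0)" for n
    by (simp add: taylor_coeff_eq_fps_nth[OF has_fps_expansion_1])
  then have "(\<lambda>n. taylor_coeff (\<lambda>z. 1) n *\<^sub>C op_power A n) sums id_blinfun"
    using sums_single[of 0 "\<lambda>_. id_blinfun :: 'a \<Rightarrow>\<^sub>L 'a"] by (simp add: eq_commute)
  then show ?thesis by (simp add: series_calculus_def sums_iff)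
qed

lemma series_calculus_ident_mult:
  assumes "0 < r" "g holomorphic_on ball 0 r"
  shows "series_calculus (\<lambda>z. z * g z) A = A o\<^sub>L series_calculus g A"
proof -
  have "(\<lambda>z. z * g z) has_fps_expansion fps_X * fps_expansion g 0"
    by (intro has_fps_expansion_mult has_fps_expansion_fps_X has_fps_expansion_ball[OF assms])
  then have tc: "taylor_coeff (\<lambda>z. z * g z) 0 = 0"
    "taylor_coeff (\<lambda>z. z * g z) (Suc n) = taylor_coeff g n" for n
    using has_fps_expansion_ball[OF assms] by (simp_all add: taylor_coeff_eq_fps_nth)
  have "(\<lambda>z. z * g z) holomorphic_on ball 0 r"
    using assms by (intro holomorphic_intros)
  then have "summable (\<lambda>n. taylor_coeff (\<lambda>z. z * g z) n *\<^sub>C op_power A n)"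
    by (rule summable_series_calculus[OF assms(1)])
  from suminf_split_head[OF this]
  have "series_calculus (\<lambda>z. z * g z) A = (\<Sum>n. A o\<^sub>L (taylor_coeff g n *\<^sub>C op_power A n))"
    unfolding series_calculus_def by (simp add: tc scaleC_compose_right[OF A])
  also have "\<dots> = A o\<^sub>L series_calculus g A"
    unfolding series_calculus_def
    by (rule bounded_linear.suminf[OF blinfun_compose.bounded_linear_right
          summable_series_calculus[OF assms], symmetric])
  finally show ?thesis .
qed

lemma series_calculus_power_mult:
  assumes "0 < r" "g holomorphic_on ball 0 r"
  shows "series_calculus (\<lambda>z. z ^ m * g z) A = op_power A m o\<^sub>L series_calculus g A"
proof (induction m)
  case (Suc m)
  have "(\<lambda>z. z ^ m * g z) holomorphic_on ball 0 r"
    using assms by (intro holomorphic_intros)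
  from series_calculus_ident_mult[OF assms(1) this] show ?case
    by (simp add: Suc mult.assoc blinfun_compose_assoc)
qed simp

lemma series_calculus_poly_mult:
  assumes "0 < r" "g holomorphic_on ball 0 r"
  shows "series_calculus (\<lambda>z. (\<Sum>m<N. c m * z ^ m) * g z) A =
    (\<Sum>m<N. c m *\<^sub>C op_power A m) o\<^sub>L series_calculus g A"
proof (induction N)
  case 0
  show ?case using series_calculus_cmult[OF assms, of 0] by simp
next
  case (Suc N)
  have hol: "(\<lambda>z. (\<Sum>m<N. c m * z ^ m) * g z) holomorphic_on ball 0 r"
    "(\<lambda>z. z ^ N * g z) holomorphic_on ball 0 r" "(\<lambda>z. c N * (z ^ N * g z)) holomorphic_on ball 0 r"
    using assms by (auto intro!: holomorphic_intros)
  have "series_calculus (\<lambda>z. (\<Sum>m<Suc N. c m * z ^ m) * g z) A =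
    series_calculus (\<lambda>z. (\<Sum>m<N. c m * z ^ m) * g z + c N * (z ^ N * g z)) A"
    by (simp add: algebra_simps)
  also have "\<dots> = series_calculus (\<lambda>z. (\<Sum>m<N. c m * z ^ m) * g z) A +
     c N *\<^sub>C series_calculus (\<lambda>z. z ^ N * g z) A"
    by (simp only: series_calculus_add[OF assms(1) hol(1,3)] series_calculus_cmult[OF assms(1) hol(2)])
  finally show ?case
    by (simp add: Suc series_calculus_power_mult[OF assms] blinfun_compose.add_left scaleC_compose_left)
qed

text \<open>Cauchy's inequality bounds the Taylor coefficients of \<open>G\<^sub>N - g\<close> by \<open>\<epsilon> \<rho>\<^sup>-\<^sup>n\<close>, and \<open>\<parallel>A\<^sup>n\<parallel> \<rho>\<^sup>-\<^sup>n\<close> is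
  summable for every \<open>\<rho>\<close>, however small.\<close>

lemma series_calculus_tendsto:
  assumes \<rho>: "0 < \<rho>" "\<rho> < r"
    and hol: "\<And>N. G N holomorphic_on ball 0 r" "g holomorphic_on ball 0 r"
    and lim: "uniform_limit (cball 0 \<rho>) G g sequentially"
  shows "(\<lambda>N. series_calculus (G N) A) \<longlonglongrightarrow> series_calculus g A"
proof -
  define K where "K = (\<Sum>n. norm (op_power A n) * (1 / \<rho>) ^ n)"
  have "summable (\<lambda>n. norm (op_power A n) * (1 / \<rho>) ^ n)"
    using rd \<rho> by (simp add: rapidly_decaying_def)
  then have K: "0 \<le> K"
    unfolding K_def using \<rho> by (intro suminf_nonneg) auto
  have r: "0 < r" using \<rho> by simp
  have bound: "norm (series_calculus (G N) A - series_calculus g A) \<le> e * K"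
    if e: "\<And>z. z \<in> cball 0 \<rho> \<Longrightarrow> dist (G N z) (g z) \<le> e" for N e
  proof -
    have h: "(\<lambda>z. G N z + (- 1) * g z) holomorphic_on ball 0 r" "(\<lambda>z. (- 1) * g z) holomorphic_on ball 0 r"
      by (intro holomorphic_intros hol)+
    have "series_calculus (\<lambda>z. G N z + (- 1) * g z) A = series_calculus (G N) A + (- 1) *\<^sub>C series_calculus g A"
      by (simp only: series_calculus_add[OF r hol(1) h(2)] series_calculus_cmult[OF r hol(2)])
    also have "\<dots> = series_calculus (G N) A - series_calculus g A"
      by (simp add: scaleC.minus_left)
    finally have eq: "series_calculus (G N) A - series_calculus g A = series_calculus (\<lambda>z. G N z + (- 1) * g z) A"
      by simp
    have "cmod (taylor_coeff (\<lambda>z. G N z + (- 1) * g z) n) \<le> e * (1 / \<rho>) ^ n" for n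
    proof (rule taylor_coeff_bound)
      show "(\<lambda>z. G N z + (- 1) * g z) holomorphic_on cball 0 \<rho>"
        using \<rho> by (intro holomorphic_on_subset[OF h(1)]) auto
      show "cmod (G N z + (- 1) * g z) \<le> e" if "cmod z = \<rho>" for z
        using e[of z] that by (simp add: dist_norm)
    qed (use \<rho> in simp)
    from rapidly_decaying_summable(2)[OF rd _ this] show ?thesis
      unfolding eq unfolding series_calculus_def K_def using \<rho> by simp
  qed
  show ?thesis
  proof (rule LIMSEQ_I)
    fix e :: real assume e: "0 < e"
    have e': "0 < e / (K + 1)" using e K by simp
    have "\<forall>\<^sub>F N in sequentially. \<forall>z\<in>cball 0 \<rho>. dist (G N z) (g z) < e / (K + 1)"
      using lim e' by (rule uniform_limitD)
    then obtain N0 where N0: "\<And>N z. N \<ge> N0 \<Longrightarrow> z \<in> cball 0 \<rho> \<Longrightarrow> dist (G N z) (g z) < e / (K + 1)"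
      unfolding eventually_sequentially by blast
    have "norm (series_calculus (G N) A - series_calculus g A) < e" if "N \<ge> N0" for N
    proof -
      have "norm (series_calculus (G N) A - series_calculus g A) \<le> e / (K + 1) * K"
        by (rule bound) (use N0[OF that] in \<open>auto intro: less_imp_le\<close>)
      also have "\<dots> < e"
        using e K by (simp add: field_simps)
      finally show ?thesis .
    qed
    then show "\<exists>no. \<forall>n\<ge>no. norm (series_calculus (G n) A - series_calculus g A) < e"
      by blast
  qed
qed

text \<open>For polynomials in the first factor this is linearity and the shift
  \<open>series_calculus_ident_mult\<close>; the general case follows by approximating \<open>f\<close> by its Taylor
  polynomials.\<close>

lemma series_calculus_mult:
  assumes r: "0 < r" and hol: "f holomorphic_on ball 0 r" "g holomorphic_on ball 0 r"
  shows "series_calculus (\<lambda>z. f z * g z) A = series_calculus f A o\<^sub>L series_calculus g A"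
proof -
  let ?p = "\<lambda>N z. \<Sum>m<N. taylor_coeff f m * z ^ m"
  have "compact (g ` cball 0 (r / 2))"
    using r by (intro compact_continuous_image holomorphic_on_imp_continuous_on
        holomorphic_on_subset[OF hol(2)]) auto
  then obtain M where M: "\<And>z. z \<in> cball 0 (r / 2) \<Longrightarrow> cmod (g z) \<le> M"
    by (meson bounded_iff compact_imp_bounded image_eqI)
  have M0: "0 \<le> M" using order_trans[OF norm_ge_zero M[of 0]] r by simp
  have unif: "uniform_limit (cball 0 (r / 2)) (\<lambda>N z. ?p N z * g z) (\<lambda>z. f z * g z) sequentially"
  proof (rule uniform_limitI)
    fix e :: real assume e: "0 < e"
    have "0 < e / (M + 1)" using e M0 by simp
    with uniform_limit_taylor[OF hol(1), of "r / 2"] r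
    have "\<forall>\<^sub>F N in sequentially. \<forall>z\<in>cball 0 (r / 2). dist (?p N z) (f z) < e / (M + 1)"
      by (intro uniform_limitD) auto
    then show "\<forall>\<^sub>F N in sequentially. \<forall>z\<in>cball 0 (r / 2). dist (?p N z * g z) (f z * g z) < e"
    proof eventually_elim
      case (elim N)
      show ?case
      proof
        fix z :: complex assume z: "z \<in> cball 0 (r / 2)"
        have "dist (?p N z * g z) (f z * g z) = dist (?p N z) (f z) * cmod (g z)"
          by (simp add: dist_norm left_diff_distrib[symmetric] norm_mult)
        also have "\<dots> \<le> e / (M + 1) * M"
          using elim z M[OF z] e M0 by (intro mult_mono) (auto intro: less_imp_le)
        also have "\<dots> < e" using e M0 by (simp add: field_simps)
        finally show "dist (?p N z * g z) (f z * g z) < e" .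
      qed
    qed
  qed
  have "(\<lambda>N. series_calculus (\<lambda>z. ?p N z * g z) A) \<longlonglongrightarrow> series_calculus (\<lambda>z. f z * g z) A"
    by (rule series_calculus_tendsto[OF _ _ _ _ unif]) (use r hol in \<open>auto intro!: holomorphic_intros\<close>)
  then have lim1: "(\<lambda>N. (\<Sum>m<N. taylor_coeff f m *\<^sub>C op_power A m) o\<^sub>L series_calculus g A) \<longlonglongrightarrow>
     series_calculus (\<lambda>z. f z * g z) A"
    by (simp only: series_calculus_poly_mult[OF r hol(2)])
  have "(\<lambda>N. \<Sum>m<N. taylor_coeff f m *\<^sub>C op_power A m) \<longlonglongrightarrow> series_calculus f A"
    unfolding series_calculus_def by (rule summable_LIMSEQ[OF summable_series_calculus[OF r hol(1)]])
  from blinfun_compose.tendsto[OF this tendsto_const]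
  show ?thesis by (rule LIMSEQ_unique[OF lim1])
qed

lemma series_calculus_power:
  assumes r: "0 < r" and hol: "f holomorphic_on ball 0 r"
  shows "series_calculus (\<lambda>z. f z ^ k) A = op_power (series_calculus f A) k"
proof (induction k)
  case (Suc k)
  have "(\<lambda>z. f z ^ k) holomorphic_on ball 0 r"
    by (intro holomorphic_intros hol)
  from series_calculus_mult[OF r hol this] show ?case
    by (simp add: Suc)
qed (simp add: series_calculus_one)

lemma series_calculus_polynomial_compose:
  assumes r: "0 < r" and hol: "f holomorphic_on ball 0 r"
  shows "series_calculus (\<lambda>z. \<Sum>k<N. c k * f z ^ k) A =
    (\<Sum>k<N. c k *\<^sub>C op_power (series_calculus f A) k)"
proof (induction N)
  case 0
  show ?case using series_calculus_cmult[OF r hol, of 0] by simp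
next
  case (Suc N)
  have hol': "(\<lambda>z. \<Sum>k<N. c k * f z ^ k) holomorphic_on ball 0 r"
    "(\<lambda>z. f z ^ N) holomorphic_on ball 0 r" "(\<lambda>z. c N * f z ^ N) holomorphic_on ball 0 r"
    by (intro holomorphic_intros hol)+
  show ?case
    using series_calculus_add[OF r hol'(1,3)] series_calculus_cmult[OF r hol'(2), of "c N"]
    by (simp add: Suc series_calculus_power[OF r hol])
qed

text \<open>The spectrum of \<open>f(A)\<close> is \<open>{f(0)}\<close>, which is the heuristic reason why the series converges
  although the norm of \<open>f(A)\<close> may be far larger than \<open>s\<close>. In the proof, convergence comes with the
  uniform convergence of the Taylor polynomials of \<open>g\<close> on the compact set \<open>f ` cball 0 (r / 2)\<close>.\<close>

lemma series_calculus_compose: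
  assumes r: "0 < r" and hol: "f holomorphic_on ball 0 r"
    and g: "g holomorphic_on ball 0 s" and sub: "f ` ball 0 r \<subseteq> ball 0 s"
  shows "(\<lambda>k. taylor_coeff g k *\<^sub>C op_power (series_calculus f A) k) sums
    series_calculus (\<lambda>z. g (f z)) A"
proof -
  have "compact (f ` cball 0 (r / 2))"
    using r by (intro compact_continuous_image holomorphic_on_imp_continuous_on
        holomorphic_on_subset[OF hol]) auto
  moreover have "f ` cball 0 (r / 2) \<noteq> {}" using r by auto
  ultimately obtain w where w: "w \<in> f ` cball 0 (r / 2)" "\<And>v. v \<in> f ` cball 0 (r / 2) \<Longrightarrow> cmod v \<le> cmod w"
    using continuous_attains_sup[of "f ` cball 0 (r / 2)" cmod] continuous_on_norm_id by blast
  have "w \<in> ball 0 s"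
    using w(1) sub r by (auto simp: image_subset_iff)
  then have "cmod w < s" by simp
  from uniform_limit_taylor[OF g this]
  have "uniform_limit (f ` cball 0 (r / 2)) (\<lambda>N v. \<Sum>k<N. taylor_coeff g k * v ^ k) g sequentially"
    by (rule uniform_limit_on_subset) (use w(2) in auto)
  then have unif: "uniform_limit (cball 0 (r / 2)) (\<lambda>N z. \<Sum>k<N. taylor_coeff g k * f z ^ k)
     (\<lambda>z. g (f z)) sequentially"
    unfolding uniform_limit_iff by simp
  have "(\<lambda>z. g (f z)) holomorphic_on ball 0 r"
    using holomorphic_on_compose_gen[OF hol g] sub by (auto simp: o_def)
  then have "(\<lambda>N. series_calculus (\<lambda>z. \<Sum>k<N. taylor_coeff g k * f z ^ k) A) \<longlonglongrightarrow>
     series_calculus (\<lambda>z. g (f z)) A"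
    by (intro series_calculus_tendsto[OF _ _ _ _ unif]) (use r hol in \<open>auto intro!: holomorphic_intros\<close>)
  then show ?thesis
    unfolding sums_def by (simp only: series_calculus_polynomial_compose[OF r hol])
qed

lemma series_calculus_ident: "series_calculus (\<lambda>z. z) A = A"
  using series_calculus_ident_mult[of 1 "\<lambda>_. 1"] by (simp add: series_calculus_one)

lemma series_calculus_inverse:
  assumes r: "0 < r" and hol: "f holomorphic_on ball 0 r"
    and g: "g holomorphic_on ball 0 s" and sub: "f ` ball 0 r \<subseteq> ball 0 s"
    and inv: "\<And>z. z \<in> ball 0 r \<Longrightarrow> g (f z) = z"
  shows "(\<lambda>k. taylor_coeff g k *\<^sub>C op_power (series_calculus f A) k) sums A"
proof -
  have "series_calculus (\<lambda>z. g (f z)) A = series_calculus (\<lambda>z. z) A"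
    by (rule series_calculus_cong[OF r, symmetric]) (auto simp: inv)
  with series_calculus_compose[OF r hol g sub] show ?thesis
    by (simp add: series_calculus_ident)
qed

end

section \<open>Power series with nonnegative coefficients\<close>

lemma fact_in_nonneg_Reals: "(fact n :: complex) \<in> \<real>\<^sub>\<ge>\<^sub>0"
  using nonneg_Reals_of_real_iff[where 'a = complex, of "fact n"] by simp

text \<open>Differentiating the series term by term keeps its coefficients nonnegative and its disk of
  convergence unchanged.\<close>

lemma higher_deriv_power_series_nonneg:
  fixes b :: "nat \<Rightarrow> real"
  assumes "\<And>k. 0 \<le> b k"
    and "\<And>w. cmod w < \<rho> \<Longrightarrow> (\<lambda>k. of_real (b k) * w ^ k) sums g w"
    and y: "0 \<le> y" "y < \<rho>"
  shows "(deriv ^^ n) g (of_real y) \<in> \<real>\<^sub>\<ge>\<^sub>0"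
  using assms(1,2)
proof (induction n arbitrary: b g)
  case 0
  have "(\<lambda>k. of_real (b k * y ^ k)) sums g (of_real y)"
    using 0(2)[of "of_real y"] y by simp
  then have "(\<lambda>k. b k * y ^ k) sums Re (g (of_real y))" "(\<lambda>k. 0) sums Im (g (of_real y))"
    by (auto dest: sums_Re sums_Im)
  moreover from this(1) have "0 \<le> Re (g (of_real y))"
    by (rule sums_le[OF _ sums_zero, rotated]) (use 0(1) y in auto)
  ultimately show ?case
    by (auto simp: complex_nonneg_Reals_iff dest: sums_unique)
next
  case (Suc n)
  let ?c = "\<lambda>k. complex_of_real (b k)"
  have sm: "summable (\<lambda>k. ?c k * w ^ k)" if "norm w < \<rho>" for w
    using Suc.prems(2)[OF that] by (rule sums_summable)
  have "(\<lambda>k. of_real (diffs b k) * w ^ k) sums deriv g w" if w: "cmod w < \<rho>" for w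
  proof -
    have "((\<lambda>z. \<Sum>k. ?c k * z ^ k) has_field_derivative (\<Sum>k. diffs ?c k * w ^ k)) (at w)"
      by (rule termdiffs_strong'[OF sm w])
    then have "(g has_field_derivative (\<Sum>k. diffs ?c k * w ^ k)) (at w)"
      by (rule has_field_derivative_transform_within_open[of _ _ _ "ball 0 \<rho>"])
        (use w Suc.prems(2) in \<open>auto simp: sums_iff\<close>)
    then have "deriv g w = (\<Sum>k. diffs ?c k * w ^ k)"
      by (rule DERIV_imp_deriv)
    moreover have "summable (\<lambda>k. diffs ?c k * w ^ k)"
      by (rule termdiff_converges[OF w sm])
    ultimately have "(\<lambda>k. diffs ?c k * w ^ k) sums deriv g w"
      by (simp add: sums_iff)
    then show ?thesis by (simp add: diffs_def)
  qed
  moreover have "0 \<le> diffs b k" for k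
    using Suc.prems(1) by (simp add: diffs_def)
  ultimately have "(deriv ^^ n) (deriv g) (of_real y) \<in> \<real>\<^sub>\<ge>\<^sub>0"
    by (intro Suc.IH)
  then show ?case by (simp add: funpow_Suc_right del: funpow.simps)
qed

text \<open>The step behind Pringsheim's theorem. Let \<open>p\<close> be a partial sum of \<open>g\<close>. The difference \<open>g - p\<close> is
  again a power series with nonnegative coefficients, so all its derivatives at \<open>y\<close> are nonnegative.
  They are also the derivatives of \<open>\<psi> - p\<close>, whose Taylor series at \<open>y\<close> therefore shows
  \<open>p(y + h) \<le> \<psi>(y + h)\<close>, even where \<open>y + h > \<rho>\<close>. So the series converges at \<open>y + h\<close>.\<close>

lemma nonneg_power_series_le_extension:
  fixes b :: "nat \<Rightarrow> real"
  assumes nonneg: "\<And>k. 0 \<le> b k"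
    and g: "\<And>w. cmod w < \<rho> \<Longrightarrow> (\<lambda>k. of_real (b k) * w ^ k) sums g w"
    and y: "0 \<le> y" "y < \<rho>"
    and hol: "\<psi> holomorphic_on ball (of_real y) s"
    and eq: "eventually (\<lambda>w. \<psi> w = g w) (nhds (of_real y))"
    and h: "0 \<le> h" "h < s"
  shows "(\<Sum>k<K. b k * (y + h) ^ k) \<le> Re (\<psi> (of_real (y + h)))"
proof -
  define p where "p w = (\<Sum>k<K. complex_of_real (b k) * w ^ k)" for w
  define c where "c k = (if k \<in> {..<K} then 0 else b k)" for k
  have diff: "(\<lambda>k. of_real (c k) * w ^ k) sums (g w - p w)" if "cmod w < \<rho>" for w
  proof -
    have "(\<lambda>k. of_real (b k) * w ^ k - (if k \<in> {..<K} then of_real (b k) * w ^ k else 0)) sums (g w - p w)"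
      unfolding p_def by (intro sums_diff g that sums_If_finite_set) simp
    also have "(\<lambda>k. of_real (b k) * w ^ k - (if k \<in> {..<K} then of_real (b k) * w ^ k else 0)) =
        (\<lambda>k. of_real (c k) * w ^ k)"
      by (auto simp: c_def)
    finally show ?thesis .
  qed
  have "(deriv ^^ n) (\<lambda>w. g w - p w) (of_real y) \<in> \<real>\<^sub>\<ge>\<^sub>0" for n
    by (rule higher_deriv_power_series_nonneg[OF _ diff y]) (use nonneg in \<open>auto simp: c_def\<close>)
  moreover have "(deriv ^^ n) (\<lambda>w. \<psi> w - p w) (of_real y) = (deriv ^^ n) (\<lambda>w. g w - p w) (of_real y)" for n
    by (rule higher_deriv_cong_ev[OF eventually_mono[OF eq] refl]) simp
  ultimately have d: "(deriv ^^ n) (\<lambda>w. \<psi> w - p w) (of_real y) \<in> \<real>\<^sub>\<ge>\<^sub>0" for n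
    by simp
  have "(\<lambda>w. \<psi> w - p w) holomorphic_on ball (of_real y) s"
    unfolding p_def by (intro holomorphic_intros hol)
  from holomorphic_power_series[OF this, of "of_real (y + h)"]
  have "(\<lambda>n. (deriv ^^ n) (\<lambda>w. \<psi> w - p w) (of_real y) / fact n * of_real h ^ n) sums
    (\<psi> (of_real (y + h)) - p (of_real (y + h)))"
    using h by (simp add: dist_norm)
  then have sums: "(\<lambda>n. Re ((deriv ^^ n) (\<lambda>w. \<psi> w - p w) (of_real y) / fact n * of_real h ^ n)) sums
    Re (\<psi> (of_real (y + h)) - p (of_real (y + h)))"
    by (rule sums_Re)
  have "0 \<le> Re ((deriv ^^ n) (\<lambda>w. \<psi> w - p w) (of_real y) / fact n * of_real h ^ n)" for n
  proof -
    have "(deriv ^^ n) (\<lambda>w. \<psi> w - p w) (of_real y) / fact n * of_real h ^ n \<in> \<real>\<^sub>\<ge>\<^sub>0"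
      using d[of n] h
      by (intro nonneg_Reals_mult_I nonneg_Reals_divide_I nonneg_Reals_pow_I fact_in_nonneg_Reals) auto
    then show ?thesis by (simp add: complex_nonneg_Reals_iff)
  qed
  then have "0 \<le> Re (\<psi> (of_real (y + h)) - p (of_real (y + h)))"
    by (rule sums_le[OF _ sums_zero sums])
  moreover have "p (of_real (y + h)) = of_real (\<Sum>k<K. b k * (y + h) ^ k)"
    by (simp add: p_def)
  ultimately show ?thesis by (simp del: of_real_sum of_real_add)
qed

section \<open>Continuing the inverse function along the real axis\<close>

text \<open>The identity theorem for \<open>g \<circ> f\<close> on the component of its domain that contains \<open>S\<close>. The equation
  is obtained on whole neighbourhoods of the points of \<open>S\<close>, which is what comparison with another
  local inverse requires.\<close>

lemma left_inverse_continuation: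
  fixes f g :: "complex \<Rightarrow> complex"
  assumes f: "f holomorphic_on D" "open D" and g: "g holomorphic_on V" "open V"
    and S: "connected S" "S \<subseteq> D" "f ` S \<subseteq> V" and a: "a \<in> S" and x: "x \<in> S"
    and near: "eventually (\<lambda>z. g (f z) = z) (nhds a)"
  shows "eventually (\<lambda>z. g (f z) = z) (nhds x)"
proof -
  define W where "W = D \<inter> f -` V"
  have W: "open W"
    unfolding W_def using f g by (intro continuous_open_preimage holomorphic_on_imp_continuous_on)
  define N where "N = connected_component_set W a"
  have N: "open N" "connected N" "N \<subseteq> W"
    by (simp_all add: N_def open_connected_component W connected_component_subset)
  have "S \<subseteq> N"
    unfolding N_def using S a by (intro connected_component_maximal) (auto simp: W_def)
  obtain T where T: "open T" "a \<in> T" "\<And>z. z \<in> T \<Longrightarrow> g (f z) = z"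
    using near by (auto simp: eventually_nhds)
  have "(\<lambda>z. g (f z)) holomorphic_on N"
    using holomorphic_on_compose_gen[OF holomorphic_on_subset[OF f(1)] g(1), of N] N(3)
    by (auto simp: W_def o_def)
  moreover have "open (T \<inter> N)" "T \<inter> N \<noteq> {}"
    using T(1,2) N(1) \<open>S \<subseteq> N\<close> a by auto
  ultimately have "g (f z) = z" if "z \<in> N" for z
    using analytic_continuation_open[of "T \<inter> N" N "\<lambda>z. g (f z)" "\<lambda>z. z" z] N(1,2) T(3) that
    by (simp add: holomorphic_on_ident)
  then show ?thesis
    unfolding eventually_nhds using N(1) \<open>S \<subseteq> N\<close> x by blast
qed

lemma real_function_deriv:
  fixes f :: "complex \<Rightarrow> complex"
  assumes f: "f holomorphic_on eball 0 R" and real: "\<And>x::real. ereal \<bar>x\<bar> < R \<Longrightarrow> f (of_real x) \<in> \<real>"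
    and x: "ereal \<bar>x\<bar> < R"
  shows "((\<lambda>t. Re (f (of_real t))) has_real_derivative Re (deriv f (of_real x))) (at x)"
    and "Im (deriv f (of_real x)) = 0"
proof -
  have "(f has_field_derivative deriv f (of_real x)) (at (of_real x))"
    using x by (intro holomorphic_derivI[OF f]) auto
  then have "((\<lambda>t. f (of_real t)) has_vector_derivative deriv f (of_real x)) (at x)"
    by (rule has_vector_derivative_real_field)
  then have Re: "((\<lambda>t. Re (f (of_real t))) has_vector_derivative Re (deriv f (of_real x))) (at x)"
    and Im: "((\<lambda>t. Im (f (of_real t))) has_vector_derivative Im (deriv f (of_real x))) (at x)"
    by (auto intro: bounded_linear.has_vector_derivative[OF bounded_linear_Re]
        bounded_linear.has_vector_derivative[OF bounded_linear_Im])
  from Re show "((\<lambda>t. Re (f (of_real t))) has_real_derivative Re (deriv f (of_real x))) (at x)"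
    by (simp add: has_real_derivative_iff_has_vector_derivative)
  have "open (complex_of_real -` eball 0 R)"
    by (intro open_vimage continuous_intros) auto
  moreover have "x \<in> complex_of_real -` eball 0 R" using x by simp
  ultimately have "((\<lambda>t. 0) has_vector_derivative Im (deriv f (of_real x))) (at x)"
    by (rule has_vector_derivative_transform_within_open[OF Im])
      (use real in \<open>auto simp: complex_is_Real_iff\<close>)
  then show "Im (deriv f (of_real x)) = 0"
    using vector_derivative_unique_at has_vector_derivative_const by metis
qed

text \<open>The situation on the real axis, free of operators: \<open>\<phi>\<close> is a local inverse of \<open>f\<close> at \<open>0\<close>, given near
  \<open>0\<close> by the power series with the nonnegative coefficients \<open>b\<close>, and \<open>f\<close> has no critical point in
  \<open>[0, \<xi>)\<close>.\<close>

locale real_inverse_pair =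
  fixes R :: ereal and f \<phi> :: "complex \<Rightarrow> complex" and \<xi> :: real and b :: "nat \<Rightarrow> real" and \<sigma> :: real
  assumes f: "f holomorphic_on eball 0 R" and f0: "f 0 = 0"
    and real: "\<And>x::real. ereal \<bar>x\<bar> < R \<Longrightarrow> f (of_real x) \<in> \<real>"
    and \<xi>: "0 < \<xi>" "ereal \<xi> < R"
    and crit: "\<And>x. 0 \<le> x \<Longrightarrow> x < \<xi> \<Longrightarrow> deriv f (of_real x) \<noteq> 0"
    and \<sigma>: "0 < \<sigma>"
    and \<phi>: "\<And>w. cmod w < \<sigma> \<Longrightarrow> (\<lambda>k. of_real (b k) * w ^ k) sums \<phi> w"
    and b: "\<And>k. 0 \<le> b k"
    and inv: "eventually (\<lambda>z. \<phi> (f z) = z) (nhds 0)"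
begin

lemma real_in_domain: "0 \<le> x \<Longrightarrow> x \<le> \<xi> \<Longrightarrow> ereal \<bar>x\<bar> < R"
  using \<xi>(2) by (metis abs_of_nonneg ereal_less_eq(3) order.strict_trans1)

lemma f_of_real: "0 \<le> x \<Longrightarrow> x \<le> \<xi> \<Longrightarrow> f (of_real x) = of_real (Re (f (of_real x)))"
  using real[OF real_in_domain] by (auto simp: complex_is_Real_iff complex_eq_iff)

lemma R_pos: "0 < R"
  using \<xi> by (metis ereal_less(2) less_trans)

lemma continuous_f: "continuous_on {0..\<xi>} (\<lambda>x. Re (f (of_real x)))"
proof -
  have "complex_of_real ` {0..\<xi>} \<subseteq> eball 0 R"
    using real_in_domain by auto
  then show ?thesis
    by (intro continuous_intros continuous_on_compose2[OF holomorphic_on_imp_continuous_on[OF f]]) auto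
qed

text \<open>Here \<open>\<phi>'(0) f'(0) = 1\<close>, and \<open>\<phi>'(0)\<close> is nonnegative.\<close>

lemma deriv_f_0: "0 < Re (deriv f 0)"
proof -
  have \<phi>hol: "\<phi> holomorphic_on ball 0 \<sigma>"
    using power_series_holomorphic[of 0 \<sigma> "\<lambda>k. of_real (b k)" \<phi>] \<phi> by simp
  have f': "(f has_field_derivative deriv f 0) (at 0)"
    using R_pos by (intro holomorphic_derivI[OF f]) (auto simp: zero_ereal_def)
  have \<phi>': "(\<phi> has_field_derivative deriv \<phi> 0) (at (f 0))"
    unfolding f0 using \<sigma> by (intro holomorphic_derivI[OF \<phi>hol]) auto
  have "((\<lambda>z. \<phi> (f z)) has_field_derivative deriv \<phi> 0 * deriv f 0) (at 0)"
    using DERIV_chain[OF \<phi>' f'] by (simp add: o_def)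
  moreover have "((\<lambda>z. \<phi> (f z)) has_field_derivative 1) (at 0)"
    using inv by (subst DERIV_cong_ev[OF refl _ refl, where g = "\<lambda>z. z"]) auto
  ultimately have 1: "deriv \<phi> 0 * deriv f 0 = 1"
    by (rule DERIV_unique)
  have "deriv \<phi> 0 \<in> \<real>\<^sub>\<ge>\<^sub>0"
    using higher_deriv_power_series_nonneg[OF b \<phi>, of \<sigma> 0 1] \<sigma> by simp
  then have "Im (deriv \<phi> 0) = 0" "0 \<le> Re (deriv \<phi> 0)"
    by (simp_all add: complex_nonneg_Reals_iff)
  with arg_cong[OF 1, of Re] have "Re (deriv \<phi> 0) * Re (deriv f 0) = 1"
    by simp
  with \<open>0 \<le> Re (deriv \<phi> 0)\<close> show ?thesis
    by (metis mult_nonneg_nonpos not_le zero_less_one)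
qed

lemma deriv_f_pos:
  assumes x: "0 \<le> x" "x < \<xi>"
  shows "0 < Re (deriv f (of_real x))"
proof (rule ccontr)
  assume "\<not> ?thesis"
  moreover have "continuous_on {0..x} (\<lambda>t. Re (deriv f (of_real t)))"
  proof -
    have "deriv f holomorphic_on eball 0 R"
      using f by (intro holomorphic_deriv) auto
    moreover have "complex_of_real ` {0..x} \<subseteq> eball 0 R"
      using real_in_domain x by auto
    ultimately have "continuous_on (complex_of_real ` {0..x}) (deriv f)"
      by (metis holomorphic_on_imp_continuous_on continuous_on_subset)
    then have "continuous_on {0..x} (\<lambda>t. deriv f (of_real t))"
      by (rule continuous_on_compose2) (auto intro!: continuous_intros)
    then show ?thesis by (rule continuous_on_Re)
  qed
  ultimately obtain t where "0 \<le> t" "t \<le> x" "Re (deriv f (of_real t)) = 0"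
    using IVT2'[of "\<lambda>t. Re (deriv f (of_real t))" x 0 0] x deriv_f_0 by auto
  moreover from this have "Im (deriv f (of_real t)) = 0"
    using x real_function_deriv(2)[OF f real] real_in_domain[of t] by simp
  ultimately show False
    using crit[of t] x by (simp add: complex_eq_iff)
qed

lemma f_strict_mono:
  assumes "0 \<le> x" "x < y" "y \<le> \<xi>"
  shows "Re (f (of_real x)) < Re (f (of_real y))"
proof (rule DERIV_pos_imp_increasing_open[OF assms(2)])
  show "continuous_on {x..y} (\<lambda>x. Re (f (of_real x)))"
    using assms by (intro continuous_on_subset[OF continuous_f]) auto
  show "\<exists>d. ((\<lambda>x. Re (f (of_real x))) has_real_derivative d) (at t) \<and> 0 < d" if "x < t" "t < y" for t
    using assms that deriv_f_pos[of t] real_function_deriv(1)[OF f real, of t] real_in_domain[of t] by auto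
qed

lemma inverse_value_exists:
  assumes "0 \<le> y" "y < Re (f (of_real \<xi>))"
  obtains x where "0 \<le> x" "x < \<xi>" "f (of_real x) = of_real y"
proof -
  obtain x where x: "0 \<le> x" "x \<le> \<xi>" "Re (f (of_real x)) = y"
    using IVT'[of "\<lambda>x. Re (f (of_real x))" 0 y \<xi>] assms \<xi> continuous_f f0 by auto
  then have "x \<noteq> \<xi>" using assms by auto
  with x that[of x] f_of_real[of x] show thesis by auto
qed

abbreviation "\<Phi> w \<equiv> \<Sum>k. complex_of_real (b k) * w ^ k"

text \<open>On the segment from \<open>0\<close> to \<open>x\<close> the values of \<open>f\<close> increase, so they stay in the disk of convergence, and
  the equation valid near \<open>0\<close> can be continued along the segment.\<close>

lemma power_series_inverts:
  assumes sm: "\<And>w. cmod w < \<rho> \<Longrightarrow> summable (\<lambda>k. complex_of_real (b k) * w ^ k)"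
    and x: "0 \<le> x" "x < \<xi>" "Re (f (of_real x)) < \<rho>"
  shows "eventually (\<lambda>z. \<Phi> (f z) = z) (nhds (of_real x))"
proof (rule left_inverse_continuation[where g = "\<lambda>w. \<Phi> w" and V = "ball 0 \<rho>" and a = 0
      and S = "complex_of_real ` {0..x}", OF f open_eball])
  show "\<Phi> holomorphic_on ball 0 \<rho>"
    by (rule power_series_holomorphic[of 0 \<rho> "\<lambda>k. of_real (b k)"])
      (use sm in \<open>auto intro!: summable_sums\<close>)
  show "open (ball (0::complex) \<rho>)" by simp
  show "connected (complex_of_real ` {0..x})"
    by (intro connected_continuous_image continuous_intros) auto
  show "complex_of_real ` {0..x} \<subseteq> eball 0 R"
    using real_in_domain x by auto
  show "f ` complex_of_real ` {0..x} \<subseteq> ball 0 \<rho>"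
  proof safe
    fix t assume t: "t \<in> {0..x}"
    have "Re (f (of_real t)) \<le> Re (f (of_real x))"
      using f_strict_mono[of t x] t x by (cases "t = x") auto
    moreover have "0 \<le> Re (f (of_real t))"
      using f_strict_mono[of 0 t] t x f0 by (cases "t = 0") auto
    moreover have "cmod (f (of_real t)) = \<bar>Re (f (of_real t))\<bar>"
      using f_of_real[of t] t x by (metis norm_of_real atLeastAtMost_iff less_imp_le order.trans)
    ultimately show "f (of_real t) \<in> ball 0 \<rho>"
      using x by simp
  qed
  show "(0::complex) \<in> complex_of_real ` {0..x}" "complex_of_real x \<in> complex_of_real ` {0..x}"
    using x by force+
  have "isCont f 0"
    using R_pos by (intro holomorphic_on_imp_differentiable_at[OF f, THEN field_differentiable_imp_continuous_at])
      (auto simp: zero_ereal_def)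
  then have lim: "filterlim f (nhds 0) (nhds 0)"
    using tendsto_at_iff_tendsto_nhds[of f 0] f0 by (simp add: isCont_def)
  have "eventually (\<lambda>w. w \<in> ball 0 \<sigma>) (nhds (0::complex))"
    using \<sigma> by (intro eventually_nhds_in_open) auto
  from eventually_compose_filterlim[OF this lim] have "eventually (\<lambda>z. f z \<in> ball 0 \<sigma>) (nhds 0)" .
  with inv show "eventually (\<lambda>z. \<Phi> (f z) = z) (nhds 0)"
    by eventually_elim (use \<phi> in \<open>auto simp: sums_iff\<close>)
qed

text \<open>Suppose that the radius of convergence \<open>\<rho>\<close> is smaller than \<open>f(\<xi>)\<close>, and let \<open>f(x\<^sub>0) = \<rho>\<close>. A local
  inverse \<open>\<psi>\<close> of \<open>f\<close> at \<open>x\<^sub>0\<close> is holomorphic on a disk of radius \<open>d\<close> around \<open>\<rho>\<close> and agrees with the sum of the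
  series near \<open>y = f(x\<^sub>1)\<close> for \<open>x\<^sub>1 < x\<^sub>0\<close> close to \<open>x\<^sub>0\<close>. Taking \<open>y > \<rho> - d/2\<close>, the disk of radius \<open>d/2\<close> around
  \<open>y\<close> reaches beyond \<open>\<rho>\<close>, so \<open>nonneg_power_series_le_extension\<close> gives convergence beyond \<open>\<rho>\<close>.\<close>

lemma conv_radius_ge: "ereal (Re (f (of_real \<xi>))) \<le> conv_radius (\<lambda>k. complex_of_real (b k))"
proof (rule ccontr)
  let ?r = "conv_radius (\<lambda>k. complex_of_real (b k))"
  assume "\<not> ?thesis"
  then have less: "?r < ereal (Re (f (of_real \<xi>)))" by simp
  have "ereal \<sigma> \<le> ?r"
  proof (rule conv_radius_geI_ex)
    fix r assume "0 < r" "ereal r < ereal \<sigma>"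
    then show "\<exists>z. norm z = r \<and> summable (\<lambda>k. complex_of_real (b k) * z ^ k)"
      using \<phi>[of "of_real r"] by (intro exI[of _ "of_real r"]) (auto simp: sums_iff)
  qed
  with \<sigma> less obtain \<rho> where \<rho>: "?r = ereal \<rho>" "0 < \<rho>" "\<rho> < Re (f (of_real \<xi>))"
    by (cases ?r) auto
  have sm: "summable (\<lambda>k. complex_of_real (b k) * w ^ k)" if "cmod w < \<rho>" for w
    using that \<rho>(1) by (intro summable_in_conv_radius) simp
  obtain x0 where x0: "0 \<le> x0" "x0 < \<xi>" "f (of_real x0) = of_real \<rho>"
    using inverse_value_exists[of \<rho>] \<rho> by auto
  have "x0 \<noteq> 0" using x0 f0 \<rho> by auto
  with x0 have x0_pos: "0 < x0" by simp
  have "complex_of_real x0 \<in> eball 0 R"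
    using real_in_domain[of x0] x0 by simp
  then obtain r where r: "0 < r" "ball (complex_of_real x0) r \<subseteq> eball 0 R" "inj_on f (ball (complex_of_real x0) r)"
    by (rule has_complex_derivative_locally_injective[OF f _ open_eball crit[OF x0(1,2)]])
  let ?B = "ball (complex_of_real x0) r"
  have fB: "f holomorphic_on ?B"
    by (rule holomorphic_on_subset[OF f r(2)])
  obtain \<psi> where \<psi>: "\<psi> holomorphic_on f ` ?B" "\<And>z. z \<in> ?B \<Longrightarrow> \<psi> (f z) = z"
    using holomorphic_has_inverse[OF fB open_ball r(3)] by metis
  have "open (f ` ?B)"
    by (rule open_mapping_thm3[OF fB open_ball r(3)])
  moreover have "complex_of_real \<rho> \<in> f ` ?B"
    using x0(3) r(1) by (metis centre_in_ball imageI)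
  ultimately obtain d where d: "0 < d" "ball (complex_of_real \<rho>) d \<subseteq> f ` ?B"
    by (metis open_contains_ball)
  have "isCont (\<lambda>t. Re (f (of_real t))) x0"
    by (rule DERIV_isCont[OF real_function_deriv(1)[OF f real]]) (use real_in_domain[of x0] x0 in simp)+
  then have "\<forall>\<^sub>F t in at x0. \<rho> - d / 2 < Re (f (of_real t))"
    unfolding isCont_def by (rule order_tendstoD(1)) (use x0(3) d(1) in simp)
  then have "\<forall>\<^sub>F t in at_left x0. \<rho> - d / 2 < Re (f (of_real t))"
    by (rule filter_leD[OF at_le, rotated]) simp
  moreover have "\<forall>\<^sub>F t in at_left x0. t \<in> {max 0 (x0 - r)<..<x0}"
    by (rule eventually_at_leftI[of "max 0 (x0 - r)"]) (use x0_pos r(1) in auto)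
  ultimately have "\<forall>\<^sub>F t in at_left x0. \<rho> - d / 2 < Re (f (of_real t)) \<and> t \<in> {max 0 (x0 - r)<..<x0}"
    by eventually_elim simp
  then obtain x1 where x1: "\<rho> - d / 2 < Re (f (of_real x1))" "0 < x1" "x0 - r < x1" "x1 < x0"
    by (auto dest!: eventually_happens'[OF trivial_limit_at_left_real])
  define y where "y = Re (f (of_real x1))"
  have fy: "f (of_real x1) = of_real y"
    unfolding y_def using x1 x0 by (intro f_of_real) auto
  have y: "0 \<le> y" "y < \<rho>" "\<rho> - d / 2 < y"
    using f_strict_mono[of 0 x1] f_strict_mono[of x1 x0] x1 x0 f0 by (auto simp: y_def)
  have x1B: "complex_of_real x1 \<in> ?B"
    using x1 by (simp add: dist_of_real dist_real_def)
  have yd: "ball (complex_of_real y) (d / 2) \<subseteq> ball (complex_of_real \<rho>) d"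
  proof
    fix w assume "w \<in> ball (complex_of_real y) (d / 2)"
    moreover have "dist (complex_of_real \<rho>) w \<le> dist (complex_of_real \<rho>) (of_real y) + dist (of_real y) w"
      by (rule dist_triangle)
    moreover have "dist (complex_of_real \<rho>) (of_real y) < d / 2"
      using y by (simp add: dist_of_real dist_real_def)
    ultimately show "w \<in> ball (complex_of_real \<rho>) d" by simp
  qed
  have \<psi>y: "\<psi> holomorphic_on ball (of_real y) (d / 2)"
    by (rule holomorphic_on_subset[OF \<psi>(1)]) (use yd d in auto)
  have "isCont \<psi> (of_real y)"
    by (rule field_differentiable_imp_continuous_at, rule holomorphic_on_imp_differentiable_at[OF \<psi>y])
      (use d in auto)
  then have lim: "filterlim \<psi> (nhds (of_real x1)) (nhds (of_real y))"
    using \<psi>(2)[OF x1B] fy tendsto_at_iff_tendsto_nhds[of \<psi> "of_real y"] by (simp add: isCont_def)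
  have "eventually (\<lambda>z. \<Phi> (f z) = z) (nhds (of_real x1))"
    by (rule power_series_inverts[OF sm]) (use x1 x0 y in \<open>auto simp: y_def\<close>)
  from eventually_compose_filterlim[OF this lim]
  have "eventually (\<lambda>w. \<Phi> (f (\<psi> w)) = \<psi> w) (nhds (of_real y))" .
  moreover have "eventually (\<lambda>w. w \<in> ball (of_real y) (d / 2)) (nhds (complex_of_real y))"
    using d by (intro eventually_nhds_in_open) auto
  ultimately have eq: "eventually (\<lambda>w. \<psi> w = \<Phi> w) (nhds (of_real y))"
  proof eventually_elim
    case (elim w)
    then obtain z where "z \<in> ?B" "w = f z" using yd d by blast
    then have "f (\<psi> w) = w" using \<psi>(2) by simp
    with elim show ?case by simp
  qed
  \<comment> \<open>The midpoint of the nonempty interval from \<open>\<rho> - y\<close> to \<open>d / 2\<close>.\<close>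
  define h where "h = (\<rho> - y + d / 2) / 2"
  have h: "0 \<le> h" "h < d / 2" "\<rho> < y + h"
    using y d by (simp_all add: h_def field_simps)
  have bound: "(\<Sum>k<K. b k * (y + h) ^ k) \<le> Re (\<psi> (of_real (y + h)))" for K
    by (rule nonneg_power_series_le_extension[OF b _ y(1,2) \<psi>y eq h(1,2)])
      (use sm in \<open>auto intro: summable_sums\<close>)
  have "summable (\<lambda>k. b k * (y + h) ^ k)"
  proof (rule bounded_imp_summable)
    show "0 \<le> b k * (y + h) ^ k" for k using b y h by simp
    show "(\<Sum>k\<le>n. b k * (y + h) ^ k) \<le> Re (\<psi> (of_real (y + h)))" for n
      using bound[of "Suc n"] by (simp add: lessThan_Suc_atMost)
  qed
  then have "summable (\<lambda>k. complex_of_real (b k * (y + h) ^ k))"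
    by (rule summable_of_real)
  then have "summable (\<lambda>k. complex_of_real (b k) * of_real (y + h) ^ k)"
    by simp
  then have "ereal (norm (complex_of_real (y + h))) \<le> ?r"
    by (rule conv_radius_geI)
  then show False
    using \<rho>(1) h y by (simp add: norm_of_real del: of_real_add)
qed

lemma nonneg_inverse_series:
  assumes y: "0 \<le> y" "y < Re (f (of_real \<xi>))"
  shows "summable (\<lambda>k. b k * y ^ k)" and "(\<Sum>k. b k * y ^ k) < \<xi>"
proof -
  let ?\<eta> = "Re (f (of_real \<xi>))"
  have sm: "summable (\<lambda>k. complex_of_real (b k) * w ^ k)" if "cmod w < ?\<eta>" for w
    by (rule summable_in_conv_radius, rule less_le_trans[OF _ conv_radius_ge]) (use that in simp)
  obtain x where x: "0 \<le> x" "x < \<xi>" "f (of_real x) = of_real y"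
    using inverse_value_exists[OF y] .
  have "eventually (\<lambda>z. \<Phi> (f z) = z) (nhds (of_real x))"
    by (rule power_series_inverts[OF sm]) (use x y in auto)
  then have "\<Phi> (of_real y) = of_real x"
    using x(3) eventually_nhds_x_imp_x by fastforce
  moreover have "summable (\<lambda>k. complex_of_real (b k) * of_real y ^ k)"
    using y by (intro sm) simp
  ultimately have "(\<lambda>k. complex_of_real (b k * y ^ k)) sums of_real x"
    by (simp add: sums_iff)
  then have "(\<lambda>k. b k * y ^ k) sums x"
    by (simp only: sums_of_real_iff)
  then show "summable (\<lambda>k. b k * y ^ k)" "(\<Sum>k. b k * y ^ k) < \<xi>"
    using x by (auto simp: sums_iff)
qed

end

section \<open>The norm estimate\<close>

lemma class_P_imp_real_inverse_pair:
  assumes R: "0 < R" and P: "class_P R f"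
    and \<xi>: "\<xi> \<in> positive_critical_points R f" "\<forall>x\<in>positive_critical_points R f. \<xi> \<le> x"
  obtains \<phi> \<sigma> r where "real_inverse_pair R f \<phi> \<xi> (\<lambda>k. Re (taylor_coeff \<phi> k)) \<sigma>"
    "\<And>k. taylor_coeff \<phi> k = of_real (Re (taylor_coeff \<phi> k))"
    "0 < r" "f holomorphic_on ball 0 r" "f ` ball 0 r \<subseteq> ball 0 \<sigma>" "\<phi> holomorphic_on ball 0 \<sigma>"
    "\<And>z. z \<in> ball 0 r \<Longrightarrow> \<phi> (f z) = z"
proof -
  have f: "f holomorphic_on eball 0 R" "f 0 = 0" "deriv f 0 \<noteq> 0"
    "\<And>x::real. ereal \<bar>x\<bar> < R \<Longrightarrow> f (of_real x) \<in> \<real>"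
    using P by (auto simp: class_P_def)
  obtain \<phi> U V where \<phi>: "\<phi> 0 = 0" "open U" "0 \<in> U" "U \<subseteq> eball 0 R" "open V" "0 \<in> V"
    "homeomorphism U V f \<phi>" "\<phi> holomorphic_on V" "\<And>n. n \<ge> 1 \<Longrightarrow> (deriv ^^ n) \<phi> 0 \<in> \<real>\<^sub>\<ge>\<^sub>0"
    using P unfolding class_P_def local_inverse_at_0_def by metis
  obtain \<sigma> where \<sigma>: "0 < \<sigma>" "ball 0 \<sigma> \<subseteq> V"
    using \<phi>(5,6) by (auto simp: open_contains_ball)
  have \<phi>hol: "\<phi> holomorphic_on ball 0 \<sigma>"
    by (rule holomorphic_on_subset[OF \<phi>(8) \<sigma>(2)])
  have "open (U \<inter> f -` ball 0 \<sigma>)"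
    using \<phi>(2,4) f(1)
    by (intro continuous_open_preimage holomorphic_on_imp_continuous_on) (auto intro: holomorphic_on_subset)
  moreover have "0 \<in> U \<inter> f -` ball 0 \<sigma>"
    using \<phi>(3) f(2) \<sigma>(1) by simp
  ultimately obtain r where r: "0 < r" "ball 0 r \<subseteq> U \<inter> f -` ball 0 \<sigma>"
    by (meson open_contains_ball)
  have inv: "\<phi> (f z) = z" if "z \<in> ball 0 r" for z
    using \<phi>(7) r(2) that by (auto simp: homeomorphism_def)
  have nonneg: "taylor_coeff \<phi> k \<in> \<real>\<^sub>\<ge>\<^sub>0" for k
  proof (cases "k = 0")
    case True
    then show ?thesis using \<phi>(1) by (simp add: taylor_coeff_def)
  next
    case False
    then have "(deriv ^^ k) \<phi> 0 \<in> \<real>\<^sub>\<ge>\<^sub>0" by (intro \<phi>(9)) simp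
    then show ?thesis
      unfolding taylor_coeff_def by (rule nonneg_Reals_divide_I[OF _ fact_in_nonneg_Reals])
  qed
  then have re: "taylor_coeff \<phi> k = of_real (Re (taylor_coeff \<phi> k))" and pos: "0 \<le> Re (taylor_coeff \<phi> k)" for k
    by (simp_all add: complex_nonneg_Reals_iff complex_eq_iff)
  have "real_inverse_pair R f \<phi> \<xi> (\<lambda>k. Re (taylor_coeff \<phi> k)) \<sigma>"
  proof
    show "0 < \<xi>" "ereal \<xi> < R" using \<xi>(1) by (auto simp: positive_critical_points_def)
    show "deriv f (of_real x) \<noteq> 0" if x: "0 \<le> x" "x < \<xi>" for x
    proof
      assume crit: "deriv f (of_real x) = 0"
      then have "x \<noteq> 0" using f(3) by auto
      moreover have "ereal x < R"
        using x(2) \<open>ereal \<xi> < R\<close> by (metis ereal_less_eq(3) less_imp_le le_less_trans)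
      ultimately have "x \<in> positive_critical_points R f"
        using x(1) crit by (simp add: positive_critical_points_def)
      then show False using \<xi>(2) x(2) by force
    qed
    show "(\<lambda>k. of_real (Re (taylor_coeff \<phi> k)) * w ^ k) sums \<phi> w" if "cmod w < \<sigma>" for w
      using holomorphic_power_series[OF \<phi>hol, of w] that
      unfolding re[symmetric] by (simp add: taylor_coeff_def)
    have "eventually (\<lambda>z. z \<in> ball 0 r) (nhds (0::complex))"
      using r(1) by (intro eventually_nhds_in_open) auto
    then show "eventually (\<lambda>z. \<phi> (f z) = z) (nhds 0)"
      by eventually_elim (rule inv)
  qed (use f \<sigma> pos in auto)
  moreover have "f holomorphic_on ball 0 r" "f ` ball 0 r \<subseteq> ball 0 \<sigma>"
    using r(2) \<phi>(4) by (auto intro: holomorphic_on_subset[OF f(1)])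
  ultimately show thesis
    using that re r(1) \<phi>hol inv by blast
qed

theorem theorem4p5:
  fixes A :: "'a::complex_banach \<Rightarrow>\<^sub>L 'a"
    and f :: "complex \<Rightarrow> complex" and R :: ereal and \<xi> :: real
  assumes "clinear_op A"
    and "quasi_nilpotent A"
    and "0 < R"
    and "admissible R f"
    and "\<xi> \<in> positive_critical_points R f"
    and "\<forall>x\<in>positive_critical_points R f. \<xi> \<le> x"
    and "norm (riesz_dunford R f A) < Re (f (of_real \<xi>))"
  shows "norm A < \<xi>"
proof (cases "(id_blinfun :: 'a \<Rightarrow>\<^sub>L 'a) = 0")
  case True
  \<comment> \<open>On the zero space the spectrum is empty, so a spectral contour need not surround \<open>0\<close>; but \<open>A = 0\<close>.\<close>
  then have "x = 0" for x :: 'a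
    by (metis blinfun_apply_id_blinfun id_apply zero_blinfun.rep_eq)
  then have "A = 0"
    by (intro blinfun_eqI) auto
  with assms(5) show ?thesis
    by (simp add: positive_critical_points_def)
next
  case False
  have P: "class_P R f" using assms(4) by (simp add: admissible_def)
  have "spectrum A \<subseteq> {0}"
  proof
    fix z assume "z \<in> spectrum A"
    then have "ennreal (cmod z) \<le> spectral_radius A"
      unfolding spectral_radius_def by (rule SUP_upper)
    with assms(2) show "z \<in> {0}"
      by (simp add: quasi_nilpotent_def ennreal_eq_0_iff)
  qed
  then have rd: "rapidly_decaying A"
    by (rule rapidly_decaying_if_spectrum_0[OF assms(1)])
  define B where "B = series_calculus f A"
  have B: "riesz_dunford R f A = B"
    unfolding B_def using P
    by (intro riesz_dunford_eq_series_calculus[OF assms(1) rd False assms(3)]) (simp add: class_P_def)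
  obtain \<phi> \<sigma> r where pair: "real_inverse_pair R f \<phi> \<xi> (\<lambda>k. Re (taylor_coeff \<phi> k)) \<sigma>"
    and re: "\<And>k. taylor_coeff \<phi> k = of_real (Re (taylor_coeff \<phi> k))"
    and r: "0 < r" "f holomorphic_on ball 0 r" "\<phi> holomorphic_on ball 0 \<sigma>" "f ` ball 0 r \<subseteq> ball 0 \<sigma>"
      "\<And>z. z \<in> ball 0 r \<Longrightarrow> \<phi> (f z) = z"
    using class_P_imp_real_inverse_pair[OF assms(3) P assms(5,6)] by metis
  have sums: "(\<lambda>k. taylor_coeff \<phi> k *\<^sub>C op_power B k) sums A"
    unfolding B_def by (rule series_calculus_inverse[OF assms(1) rd r])
  let ?b = "\<lambda>k. Re (taylor_coeff \<phi> k)"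
  interpret real_inverse_pair R f \<phi> \<xi> ?b \<sigma> by (rule pair)
  have \<beta>: "0 \<le> norm B" "norm B < Re (f (of_real \<xi>))"
    using assms(7) B by auto
  have "norm (taylor_coeff \<phi> k *\<^sub>C op_power B k) \<le> ?b k * norm B ^ k" for k
    using mult_left_mono[OF norm_op_power_le b]
    by (subst re) (simp add: norm_scaleC abs_of_nonneg[OF b])
  then have "norm (\<Sum>k. taylor_coeff \<phi> k *\<^sub>C op_power B k) \<le> (\<Sum>k. ?b k * norm B ^ k)"
    by (intro norm_suminf_le nonneg_inverse_series(1) \<beta>)
  also have "\<dots> < \<xi>"
    by (rule nonneg_inverse_series(2)[OF \<beta>])
  finally show ?thesis
    using sums by (simp add: sums_iff)
qed

end
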